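(* Let $\mathbb{F}=\mathbb{R}$ or $\mathbb{F}=\mathbb{C}$, and set $\alpha=1$ if $\mathbb{F}=\mathbb{R}$, $\alpha=0$ if $\mathbb{F}=\mathbb{C}$. Let $A\in\mathbb{F}^{n\times n}$ be a fixed conjugate symmetric matrix ($A=A^*$), and let $k,\ell$ be positive integers with $\ell\le n$ and $\ell>k+\alpha$. Draw $\Omega\in\mathbb{F}^{n\times k}$ and $\Psi\in\mathbb{F}^{\ell\times n}$ independently from the standard normal distribution over $\mathbb{F}$. Let $\hat A=QX$ be the rank-$k$ approximation of $A$ computed from the sketch $(A\Omega,\Psi A)$, as defined in the context, and let $$\hat A_{\mathrm{sym}}:=\tfrac12(\hat A+\hat A^* )=\tfrac12(QX+X^*Q^* ),$$ which is a conjugate symmetric matrix of rank at most $2k$. Then $$ \mathbb{E}\,\|A-\hat A_{\mathrm{sym}}\|_{\mathrm F}^2\;\le\;(1+f(k,\ell))\cdot\min_{\varrho<k-\alpha}\,(1+f(\varrho,k))\cdot\tau_{\varrho+1}^2(A), $$ where the index $\varrho$ ranges over natural numbers $\varrho\ge1$ with $\varrho<k-\alpha$ (a minimum over the empty set is $+\infty$).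
   Context: Standard normal matrices: a real standard normal matrix has independent $N(0,1)$ entries; a complex standard normal matrix is $G_1+\mathrm{i}G_2$ with $G_1,G_2$ independent real standard normal matrices. ${}^*$ is the (conjugate) transpose. $f(s,t):=s/(t-s-\alpha)$ for integers with $t>s+\alpha>\alpha$. Tail energy: $\tau_j^2(A):=\min_{\operatorname{rank}(B)<j}\|A-B\|_{\mathrm F}^2=\sum_{i\ge j}\sigma_i^2(A)$, where $\sigma_i(A)$ is the $i$th largest singular value (zero for $i>n$) and $\|\cdot\|_{\mathrm F}$ is the Frobenius norm. The approximation: form $Y:=A\Omega\in\mathbb{F}^{n\times k}$ and $W:=\Psi A\in\mathbb{F}^{\ell\times n}$. Compute an orthogonal--triangular (QR) factorization $Y=QR$, where $Q\in\mathbb{F}^{n\times k}$ has orthonormal columns; $Q$ is obtained from $Y$ by a fixed (measurable) procedure, so it is a function of $\Omega$ only (for fixed $A$). Set $X:=(\Psi Q)^\dagger W\in\mathbb{F}^{k\times n}$, where $\dagger$ is the Moore--Penrose pseudoinverse, and $\hat A:=QX$. The same matrix $\hat A_{\mathrm{sym}}$ may be presented in factored form: if $[\,Q\ \ X^*\,]=U[\,T_1\ \ T_2\,]$ is an orthogonal--triangular factorization and $S:=\frac12(T_1T_2^*+T_2T_1^* )$, then $\hat A_{\mathrm{sym}}=USU^*$. $\mathbb{E}$ is expectation over both $\Omega$ and $\Psi$. *)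

theory Defs
  imports
    "HOL-Probability.Probability"
    "Jordan_Normal_Form.Conjugate"
begin

text \<open>
  A matrix with m rows and n columns over the field \<open>'a\<close> is an element of \<open>'a^'n^'m\<close> with
  \<open>m = CARD('m)\<close> and \<open>n = CARD('n)\<close>.  The overloaded \<^const>\<open>conjugate\<close> is the identity on
  \<^typ>\<open>real\<close> and \<^const>\<open>cnj\<close> on \<^typ>\<open>complex\<close>, so the definitions below serve both fields.
\<close>

definition ctrans :: "'a::conjugate^'n^'m \<Rightarrow> 'a^'m^'n" where
  "ctrans A = (\<chi> i j. conjugate (A $ j $ i))"

text \<open>The library norm on \<open>'a^'n^'m\<close> is the Frobenius norm, not an operator norm.\<close>

lemma norm_matrix_eq_frobenius:
  fixes A :: "'a::real_normed_vector^'n^'m"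
  shows "(norm A)\<^sup>2 = (\<Sum>i\<in>UNIV. \<Sum>j\<in>UNIV. (norm (A $ i $ j))\<^sup>2)"
  by (simp add: norm_vec_def L2_set_def sum_nonneg)


text \<open>The four Penrose equations, which determine the pseudoinverse over the reals and over the
  complex numbers.\<close>

definition is_pinv :: "'a::{field,conjugate}^'n^'m \<Rightarrow> 'a^'m^'n \<Rightarrow> bool" where
  "is_pinv A X \<longleftrightarrow>
     A ** X ** A = A \<and> X ** A ** X = X \<and>
     ctrans (A ** X) = A ** X \<and> ctrans (X ** A) = X ** A"

definition pinv :: "'a::{field,conjugate}^'n^'m \<Rightarrow> 'a^'m^'n" where
  "pinv A = (THE X. is_pinv A X)"

text \<open>
  The squared tail energy \<open>\<tau>\<^sub>j\<^sup>2(A)\<close>, for \<open>j \<ge> 1\<close>.  The minimum over an infinite set of matrices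
  is written as an infimum; it is attained by truncating a singular value decomposition.
\<close>

definition tail_energy_sq :: "nat \<Rightarrow> 'a::real_normed_field^'n^'m \<Rightarrow> real" where
  "tail_energy_sq j A = (INF B\<in>{B. rank B < j}. (norm (A - B))\<^sup>2)"

text \<open>\<open>f_ratio \<alpha> s t\<close> is \<open>f(s,t)\<close>, meaningful for \<open>t > s + \<alpha> > \<alpha>\<close>.\<close>

definition f_ratio :: "nat \<Rightarrow> nat \<Rightarrow> nat \<Rightarrow> real" where
  "f_ratio \<alpha> s t = real s / (real t - real s - real \<alpha>)"


text \<open>
  Independence of two random variables.  The library's \<open>prob_space.indep_var\<close> requires both to
  have the same type, hence the same matrix format.
\<close>

definition indep_rv ::
    "'w measure \<Rightarrow> ('w \<Rightarrow> 'b::topological_space) \<Rightarrow> ('w \<Rightarrow> 'c::topological_space) \<Rightarrow> bool" where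
  "indep_rv M X Y \<longleftrightarrow>
     X \<in> borel_measurable M \<and> Y \<in> borel_measurable M \<and>
     prob_space.indep_set M
       {X -` B \<inter> space M |B. B \<in> sets borel} {Y -` B \<inter> space M |B. B \<in> sets borel}"

definition real_std_normal :: "'w measure \<Rightarrow> ('w \<Rightarrow> real^'n^'m) \<Rightarrow> bool" where
  "real_std_normal M G \<longleftrightarrow>
     prob_space.indep_vars M (\<lambda>_. borel) (\<lambda>(i, j) \<omega>. G \<omega> $ i $ j) UNIV \<and>
     (\<forall>i j. distributed M lborel (\<lambda>\<omega>. G \<omega> $ i $ j) std_normal_density)"

text \<open>The entries of a complex standard normal matrix have variance 2, not 1.\<close>

definition complex_std_normal :: "'w measure \<Rightarrow> ('w \<Rightarrow> complex^'n^'m) \<Rightarrow> bool" where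
  "complex_std_normal M G \<longleftrightarrow>
     (\<exists>G1 G2. real_std_normal M G1 \<and> real_std_normal M G2 \<and> indep_rv M G1 G2 \<and>
        (\<forall>\<omega>\<in>space M. \<forall>i j. G \<omega> $ i $ j = Complex (G1 \<omega> $ i $ j) (G2 \<omega> $ i $ j)))"


text \<open>
  A fixed measurable rule \<open>q\<close> that selects the orthonormal factor of a QR factorization of every
  matrix \<open>Y\<close>.  When \<open>Y\<close> is rank deficient this factor is not determined by \<open>Y\<close>
  up to phases, and the rule may choose any of the possible ones.  The linear order on the
  column index type \<open>'k\<close> is needed only to express that \<open>R\<close> is upper triangular.
\<close>

definition qr_rule ::
    "('a::{real_normed_field,conjugate}^'k::{finite,linorder}^'n
       \<Rightarrow> 'a^'k::{finite,linorder}^'n) \<Rightarrow> bool" where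
  "qr_rule q \<longleftrightarrow>
     q \<in> borel_measurable borel \<and>
     (\<forall>Y. ctrans (q Y) ** q Y = mat 1 \<and>
        (\<exists>R. (\<forall>i j. j < i \<longrightarrow> R $ i $ j = 0) \<and> Y = q Y ** R))"

text \<open>\<open>A_hat q A \<Omega> \<Psi>\<close> is \<open>Q X\<close> with \<open>X = (\<Psi> Q)\<^sup>\<dagger> W\<close>, for the sketch \<open>Y = A \<Omega>\<close>, \<open>W = \<Psi> A\<close>.\<close>

definition A_hat ::
    "('a::{field,conjugate}^'k^'n \<Rightarrow> 'a^'k^'n) \<Rightarrow> 'a^'n^'n \<Rightarrow> 'a^'k^'n \<Rightarrow> 'a^'n^'l \<Rightarrow> 'a^'n^'n" where
  "A_hat q A \<Omega> \<Psi> =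
     (let Y = A ** \<Omega>; W = \<Psi> ** A; Q = q Y; X = pinv (\<Psi> ** Q) ** W in Q ** X)"

definition A_hat_sym ::
    "('a::{real_normed_field,conjugate}^'k^'n \<Rightarrow> 'a^'k^'n) \<Rightarrow> 'a^'n^'n \<Rightarrow> 'a^'k^'n \<Rightarrow> 'a^'n^'l
       \<Rightarrow> 'a^'n^'n" where
  "A_hat_sym q A \<Omega> \<Psi> = (1/2) *\<^sub>R (A_hat q A \<Omega> \<Psi> + ctrans (A_hat q A \<Omega> \<Psi>))"

text \<open>
  The right-hand side of the error bound, with \<open>\<alpha>\<close> the field parameter.  In \<^typ>\<open>ennreal\<close> the
  infimum over the finite index set is its minimum, and it is \<open>\<infinity>\<close> if that set is empty.
\<close>

definition sym_error_bound :: "nat \<Rightarrow> nat \<Rightarrow> nat \<Rightarrow> 'a::real_normed_field^'n^'n \<Rightarrow> ennreal" where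
  "sym_error_bound \<alpha> k l A =
     ennreal (1 + f_ratio \<alpha> k l) *
     (INF \<rho>\<in>{\<rho>. 1 \<le> \<rho> \<and> \<rho> + \<alpha> < k}.
        ennreal ((1 + f_ratio \<alpha> \<rho> k) * tail_energy_sq (\<rho> + 1) A))"

end

theory Submission
  imports Defs "HOL-Real_Asymp.Real_Asymp"
begin

text \<open>
  Let \<open>v\<^sub>1, \<dots>, v\<^sub>r\<close> be orthonormal, \<open>G\<close> a Gaussian matrix with \<open>l\<close> rows, \<open>p\<^sub>i\<close> the component of \<open>G v\<^sub>i\<close>
  orthogonal to the other \<open>G v\<^sub>j\<close>, and \<open>h\<^sub>i = p\<^sub>i / |p\<^sub>i|\<^sup>2\<close> the dual basis. The oblique residual
  \<open>a - \<Sum>\<^sub>i \<langle>G a, h\<^sub>i\<rangle> v\<^sub>i\<close> has squared norm \<open>|e|\<^sup>2 + \<Sum>\<^sub>i |\<langle>G e, h\<^sub>i\<rangle>|\<^sup>2\<close>, where \<open>e\<close> is the component of \<open>a\<close>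
  orthogonal to the \<open>v\<^sub>i\<close>. Since \<open>G e\<close> and the \<open>G v\<^sub>j\<close> are independent Gaussian vectors, the expectation
  reduces to an inverse moment of a chi-square variable and is at most \<open>(1 + f(r, l)) |e|\<^sup>2\<close>.

  This is used twice. With \<open>G = \<Psi>\<close> and the columns of \<open>Q\<close>, the columns of \<open>A - Q X\<close> are oblique residuals
  of the columns of \<open>A\<close>. With \<open>G = \<Omega>\<^sup>*\<close> and an orthonormal basis of the row space of a competitor \<open>B\<close> of
  rank at most \<open>\<rho>\<close>, they bound \<open>|A - Q Q\<^sup>* A|\<close>, because \<open>Q Q\<^sup>* A\<close> is the best approximation of \<open>A\<close> in the
  range of \<open>A \<Omega>\<close>; as \<open>B\<close> is arbitrary, no singular value decomposition is needed. Finally, taking the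
  Hermitian part of \<open>Q X\<close> does not increase the error, since \<open>A\<close> is Hermitian.

  Independence and rotation invariance come from one identity: the rotation of \<open>V \<times> U\<close> that exchanges \<open>U\<close>
  with an isometric copy of \<open>U\<close> inside \<open>V\<close> is a product of three shears, hence preserves Lebesgue measure.
\<close>

section \<open>Standard Gaussian measure on a Euclidean space\<close>

definition gauss_density :: "'v::euclidean_space \<Rightarrow> real" where
  "gauss_density x = (\<Prod>b\<in>Basis. std_normal_density (x \<bullet> b))"

text \<open>A field of real dimension \<open>d\<close> contributes \<open>d\<close> independent
  N(0,1) coordinates per matrix entry, so complex entries have variance 2, in agreement with
  \<open>complex_std_normal\<close>.\<close>

definition gauss :: "'v::euclidean_space measure" where
  "gauss = density lborel (\<lambda>x. ennreal (gauss_density x))"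

text \<open>The density depends on \<open>x\<close> through its norm alone, which is the source of
  rotation invariance.\<close>

lemma gauss_density_eq:
  fixes x :: "'v::euclidean_space"
  shows "gauss_density x = (1 / sqrt (2 * pi)) ^ DIM('v) * exp (- (norm x)\<^sup>2 / 2)"
proof -
  have "(norm x)\<^sup>2 = (\<Sum>b\<in>Basis. (x \<bullet> b)\<^sup>2)"
    by (subst power2_norm_eq_inner, subst euclidean_inner) (simp add: power2_eq_square)
  then have "exp (- (norm x)\<^sup>2 / 2) = (\<Prod>b\<in>Basis. exp (- (x \<bullet> b)\<^sup>2 / 2))"
    by (simp add: exp_sum[symmetric] sum_negf sum_divide_distrib)
  then show ?thesis
    by (simp add: gauss_density_def std_normal_density_def prod.distrib prod_dividef power_divide)
qed

lemma gauss_density_nonneg [simp]: "0 \<le> gauss_density x"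
  by (simp add: gauss_density_def prod_nonneg)

lemma gauss_density_measurable [measurable]: "gauss_density \<in> borel_measurable borel"
  unfolding gauss_density_def[abs_def] by measurable

lemma sets_gauss [simp, measurable_cong]: "sets gauss = sets borel"
  and space_gauss [simp]: "space gauss = UNIV"
  by (simp_all add: gauss_def)

lemma nn_integral_gauss:
  "f \<in> borel_measurable borel \<Longrightarrow>
     (\<integral>\<^sup>+x. f x \<partial>gauss) = (\<integral>\<^sup>+x. ennreal (gauss_density x) * f x \<partial>lborel)"
  unfolding gauss_def by (subst nn_integral_density) auto

lemma nn_integral_gauss_prod:
  fixes f :: "'v::euclidean_space \<Rightarrow> real \<Rightarrow> real"
  assumes [measurable]: "\<And>b. b \<in> Basis \<Longrightarrow> f b \<in> borel_measurable borel"
    and nonneg: "\<And>b x. b \<in> Basis \<Longrightarrow> 0 \<le> f b x"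
  shows "(\<integral>\<^sup>+x. ennreal (\<Prod>b\<in>Basis. f b (x \<bullet> b)) \<partial>gauss) =
    (\<Prod>b\<in>(Basis::'v set). \<integral>\<^sup>+t. ennreal (std_normal_density t * f b t) \<partial>lborel)"
proof -
  have "(\<integral>\<^sup>+x. ennreal (\<Prod>b\<in>Basis. f b (x \<bullet> b)) \<partial>gauss) =
      (\<integral>\<^sup>+x. (\<Prod>b\<in>Basis. ennreal (std_normal_density (x \<bullet> b) * f b (x \<bullet> b))) \<partial>lborel)"
    by (subst nn_integral_gauss, measurable, intro nn_integral_cong)
       (simp add: gauss_density_def ennreal_mult'[symmetric] prod.distrib[symmetric] prod_ennreal nonneg prod_nonneg)
  also have "\<dots> = (\<Prod>b\<in>(Basis::'v set). \<integral>\<^sup>+t. ennreal (std_normal_density t * f b t) \<partial>lborel)"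
    by (rule nn_integral_lborel_prod[where f = "\<lambda>b t. ennreal (std_normal_density t * f b t)"]) simp_all
  finally show ?thesis .
qed

lemma nn_integral_std_normal_density [simp]:
  "(\<integral>\<^sup>+t. ennreal (std_normal_density t) \<partial>lborel) = 1"
  by (subst nn_integral_eq_integral) auto

lemma prob_space_gauss: "prob_space (gauss :: 'v::euclidean_space measure)"
  using nn_integral_gauss_prod[of "\<lambda>(_::'v) _. 1"]
  by (intro prob_spaceI) simp

interpretation gauss: prob_space "gauss :: 'v::euclidean_space measure"
  by (rule prob_space_gauss)

interpretation gauss_pair: pair_prob_space
  "gauss :: 'v::euclidean_space measure" "gauss :: 'u::euclidean_space measure" ..

lemma gauss_density_Pair: "gauss_density (x, y) = gauss_density x * gauss_density y"
  by (simp add: gauss_density_eq norm_Pair power_add add_divide_distrib exp_add[symmetric])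

text \<open>Squared norms add over a product space, so densities multiply. Independence is expressed
  throughout by regarding two Gaussians as a single one on the product.\<close>

lemma gauss_pair_measure:
  "(gauss :: 'v::euclidean_space measure) \<Otimes>\<^sub>M (gauss :: 'u::euclidean_space measure) = gauss"
proof -
  have "(gauss :: 'v measure) \<Otimes>\<^sub>M (gauss :: 'u measure) =
      density (lborel \<Otimes>\<^sub>M lborel) (\<lambda>(x, y). ennreal (gauss_density x) * ennreal (gauss_density y))"
    unfolding gauss_def
    by (rule pair_measure_density) 
       (auto simp: sigma_finite_lborel gauss_def[symmetric] gauss.sigma_finite_measure_axioms)
  also have "(\<lambda>(x::'v, y::'u). ennreal (gauss_density x) * ennreal (gauss_density y)) =
      (\<lambda>p. ennreal (gauss_density p))"
    by (auto simp: gauss_density_Pair ennreal_mult'[symmetric])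
  finally show ?thesis by (simp add: lborel_prod gauss_def)
qed

lemma nn_integral_gauss_pair:
  assumes "F \<in> borel_measurable borel"
  shows "(\<integral>\<^sup>+p. F p \<partial>(gauss :: ('v::euclidean_space \<times> 'u::euclidean_space) measure)) =
    (\<integral>\<^sup>+x. \<integral>\<^sup>+y. F (x, y) \<partial>gauss \<partial>gauss)"
  unfolding gauss_pair_measure[symmetric]
  using assms by (subst gauss.nn_integral_fst) (simp_all add: measurable_cong_sets[OF sets_pair_measure_cong[OF sets_gauss sets_gauss]] borel_prod)

section \<open>Shears, rotations and the invariance of the Gaussian measure\<close>

lemma measurable_linear:
  fixes L :: "'u::euclidean_space \<Rightarrow> 'v::euclidean_space"
  shows "linear L \<Longrightarrow> L \<in> borel_measurable borel"
  by (intro borel_measurable_continuous_onI linear_continuous_on linear_conv_bounded_linear[THEN iffD1])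

text \<open>With the second coordinate fixed the shear is a translation of the first, so translation
  invariance and Tonelli suffice.\<close>

lemma nn_integral_lborel_shear1:
  fixes L :: "'u::euclidean_space \<Rightarrow> 'v::euclidean_space"
  assumes [measurable]: "L \<in> borel_measurable borel" "H \<in> borel_measurable borel"
  shows "(\<integral>\<^sup>+p. H (fst p + L (snd p), snd p) \<partial>lborel) = (\<integral>\<^sup>+p. H p \<partial>(lborel :: ('v \<times> 'u) measure))"
proof -
  have [measurable]: "H \<in> borel_measurable (borel \<Otimes>\<^sub>M borel)" by (simp add: borel_prod)
  have "(\<integral>\<^sup>+p. H (fst p + L (snd p), snd p) \<partial>lborel) =
      (\<integral>\<^sup>+y. \<integral>\<^sup>+x. H (L y + x, y) \<partial>lborel \<partial>lborel)"
    unfolding lborel_prod[symmetric]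
    by (subst lborel_pair.nn_integral_snd[symmetric]) (auto simp: add.commute)
  also have "\<dots> = (\<integral>\<^sup>+y. \<integral>\<^sup>+x. H (x, y) \<partial>lborel \<partial>lborel)"
  proof (rule nn_integral_cong)
    fix y
    have "(\<integral>\<^sup>+x. H (x, y) \<partial>lborel) = (\<integral>\<^sup>+x. H (x, y) \<partial>distr lborel borel ((+) (L y)))"
      by (simp add: lborel_distr_plus)
    also have "\<dots> = (\<integral>\<^sup>+x. H (L y + x, y) \<partial>lborel)"
      by (subst nn_integral_distr) auto
    finally show "(\<integral>\<^sup>+x. H (L y + x, y) \<partial>lborel) = (\<integral>\<^sup>+x. H (x, y) \<partial>lborel)" ..
  qed
  also have "\<dots> = (\<integral>\<^sup>+p. H p \<partial>(lborel :: ('v \<times> 'u) measure))"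
    unfolding lborel_prod[symmetric]
    by (subst lborel_pair.nn_integral_snd[symmetric]) auto
  finally show ?thesis .
qed

lemma nn_integral_lborel_shear2:
  fixes L :: "'v::euclidean_space \<Rightarrow> 'u::euclidean_space"
  assumes [measurable]: "L \<in> borel_measurable borel" "H \<in> borel_measurable borel"
  shows "(\<integral>\<^sup>+p. H (fst p, snd p + L (fst p)) \<partial>lborel) = (\<integral>\<^sup>+p. H p \<partial>(lborel :: ('v \<times> 'u) measure))"
proof -
  have [measurable]: "H \<in> borel_measurable (borel \<Otimes>\<^sub>M borel)" by (simp add: borel_prod)
  have "(\<integral>\<^sup>+p. H (fst p, snd p + L (fst p)) \<partial>lborel) =
      (\<integral>\<^sup>+x. \<integral>\<^sup>+y. H (x, L x + y) \<partial>lborel \<partial>lborel)"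
    unfolding lborel_prod[symmetric]
    by (subst lborel.nn_integral_fst[symmetric]) (auto simp: add.commute)
  also have "\<dots> = (\<integral>\<^sup>+x. \<integral>\<^sup>+y. H (x, y) \<partial>lborel \<partial>lborel)"
  proof (rule nn_integral_cong)
    fix x
    have "(\<integral>\<^sup>+y. H (x, y) \<partial>lborel) = (\<integral>\<^sup>+y. H (x, y) \<partial>distr lborel borel ((+) (L x)))"
      by (simp add: lborel_distr_plus)
    also have "\<dots> = (\<integral>\<^sup>+y. H (x, L x + y) \<partial>lborel)"
      by (subst nn_integral_distr) auto
    finally show "(\<integral>\<^sup>+y. H (x, L x + y) \<partial>lborel) = (\<integral>\<^sup>+y. H (x, y) \<partial>lborel)" ..
  qed
  also have "\<dots> = (\<integral>\<^sup>+p. H p \<partial>(lborel :: ('v \<times> 'u) measure))"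
    unfolding lborel_prod[symmetric]
    by (subst lborel.nn_integral_fst[symmetric]) auto
  finally show ?thesis .
qed

text \<open>\<open>L\<close> is an isometric embedding, \<open>L'\<close> is its adjoint, and
  \<open>L (L' x)\<close> is the orthogonal projection of \<open>x\<close> onto the range of
  \<open>L\<close>. The name refers to \<open>L'\<close>.\<close>

locale coisometry =
  fixes L :: "'u::euclidean_space \<Rightarrow> 'v::euclidean_space" and L' :: "'v \<Rightarrow> 'u"
  assumes linear_L: "linear L" and linear_L': "linear L'"
    and adjoint: "x \<bullet> L y = L' x \<bullet> y"
    and left_inverse: "L' (L y) = y"
begin

lemma L_measurable [measurable]: "L \<in> borel_measurable borel"
  and L'_measurable [measurable]: "L' \<in> borel_measurable borel"
  using linear_L linear_L' by (auto intro: measurable_linear)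

text \<open>Since \<open>x - L (L' x)\<close> is orthogonal to the range of \<open>L\<close>,
  Pythagoras evaluates both norms.\<close>

lemma norm_rotate: "norm (x - L (L' x) + L y, - L' x) = norm (x, y)"
proof -
  let ?a = "x - L (L' x)"
  have LL: "L a \<bullet> L b = a \<bullet> b" for a b by (simp only: adjoint left_inverse)
  have a: "?a \<bullet> L y = 0"
    by (simp only: adjoint linear_diff[OF linear_L'] left_inverse diff_self inner_zero_left)
  have "x \<bullet> x = (?a + L (L' x)) \<bullet> (?a + L (L' x))" by simp
  also have "\<dots> = ?a \<bullet> ?a + L' x \<bullet> L' x"
    using adjoint[of ?a "L' x"]
    by (simp only: inner_add_left inner_add_right LL inner_commute[of "L (L' x)" ?a]
        linear_diff[OF linear_L'] left_inverse diff_self inner_zero_left add_0_left add_0_right)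
  finally have "(norm (?a + L y, - L' x))\<^sup>2 = (norm (x, y))\<^sup>2"
    using a by (simp add: norm_Pair power2_norm_eq_inner inner_add_left inner_add_right LL
        inner_commute[of "L y" ?a])
  then show ?thesis by simp
qed

text \<open>The rotation is the composition of the shears \<open>(x, y) \<mapsto> (x + L y, y)\<close>,
  \<open>(x, y) \<mapsto> (x, y - L' x)\<close> and \<open>(x, y) \<mapsto> (x + L y, y)\<close>.\<close>

lemma nn_integral_rotate:
  assumes [measurable]: "F \<in> borel_measurable borel"
  shows "(\<integral>\<^sup>+p. F (fst p - L (L' (fst p)) + L (snd p), - L' (fst p)) \<partial>gauss) =
    (\<integral>\<^sup>+p. F p \<partial>gauss)"
proof -
  let ?T = "\<lambda>p. (fst p - L (L' (fst p)) + L (snd p), - L' (fst p))"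
  have [measurable]: "F \<in> borel_measurable (borel \<Otimes>\<^sub>M borel)" by (simp add: borel_prod)
  have T: "?T \<in> borel_measurable borel" unfolding borel_prod[symmetric] by measurable
  have [measurable]: "gauss_density \<in> borel_measurable (borel \<Otimes>\<^sub>M borel)" by (simp add: borel_prod)
  define H where "H = (\<lambda>p. ennreal (gauss_density p) * F p)"
  have H: "H \<in> borel_measurable borel" unfolding H_def by measurable
  define H1 where "H1 = (\<lambda>p. H (fst p + L (snd p), snd p))"
  define H2 where "H2 = (\<lambda>p. H1 (fst p, snd p + - L' (fst p)))"
  have [measurable]: "H \<in> borel_measurable (borel \<Otimes>\<^sub>M borel)" using H by (simp add: borel_prod)
  have H1[measurable]: "H1 \<in> borel_measurable (borel \<Otimes>\<^sub>M borel)" unfolding H1_def by measurable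
  have H2: "H2 \<in> borel_measurable (borel \<Otimes>\<^sub>M borel)" unfolding H2_def by measurable
  have "(\<integral>\<^sup>+p. F (?T p) \<partial>gauss) = (\<integral>\<^sup>+p. ennreal (gauss_density p) * F (?T p) \<partial>lborel)"
    by (rule nn_integral_gauss) (use measurable_compose[OF T assms] in simp)
  \<comment> \<open>The density is a function of the norm, so the rotation may be inserted into its
    argument as well.\<close>
  also have "\<dots> = (\<integral>\<^sup>+p. H (?T p) \<partial>lborel)"
    by (intro nn_integral_cong)
       (simp add: H_def gauss_density_eq norm_rotate)
  \<comment> \<open>After the first shear the second one gives
    \<open>y - L' (x + L y) = - L' x\<close>, because \<open>L' (L y) = y\<close>.\<close>
  also have "\<dots> = (\<integral>\<^sup>+p. H2 (fst p + L (snd p), snd p) \<partial>lborel)"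
    by (intro nn_integral_cong)
       (simp add: H2_def H1_def linear_add[OF linear_L'] left_inverse linear_neg[OF linear_L] linear_add[OF linear_L]
          linear_diff[OF linear_L] algebra_simps)
  also have "\<dots> = (\<integral>\<^sup>+p. H2 p \<partial>lborel)"
    using H2 by (intro nn_integral_lborel_shear1) (auto simp: borel_prod)
  also have "\<dots> = (\<integral>\<^sup>+p. H1 p \<partial>lborel)"
    unfolding H2_def using H1 by (intro nn_integral_lborel_shear2[where L="\<lambda>x. - L' x"]) (auto simp: borel_prod)
  also have "\<dots> = (\<integral>\<^sup>+p. H p \<partial>lborel)"
    unfolding H1_def using H by (intro nn_integral_lborel_shear1) (auto simp: borel_prod)
  also have "\<dots> = (\<integral>\<^sup>+p. F p \<partial>gauss)"
    unfolding H_def by (subst nn_integral_gauss) auto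
  finally show ?thesis .
qed

text \<open>The component of \<open>x\<close> in the range of \<open>L\<close> may be replaced by an
  independent Gaussian. The rotation performs this exchange, and every later independence argument
  is an instance of it.\<close>

lemma nn_integral_resample:
  assumes [measurable]: "F \<in> borel_measurable borel"
  shows "(\<integral>\<^sup>+x. F x \<partial>gauss) = (\<integral>\<^sup>+x. \<integral>\<^sup>+y. F (x - L (L' x) + L y) \<partial>gauss \<partial>gauss)"
proof -
  have "(\<integral>\<^sup>+x. F x \<partial>gauss) = (\<integral>\<^sup>+p. F (fst p) \<partial>(gauss :: ('v \<times> 'u) measure))"
    by (subst nn_integral_gauss_pair) 
       (simp_all add: borel_prod[symmetric] gauss.emeasure_space_1[simplified])
  also have "\<dots> = (\<integral>\<^sup>+p. F (fst p - L (L' (fst p)) + L (snd p)) \<partial>(gauss :: ('v \<times> 'u) measure))"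
    by (subst nn_integral_rotate[symmetric]) (simp_all add: borel_prod[symmetric])
  also have "\<dots> = (\<integral>\<^sup>+x. \<integral>\<^sup>+y. F (x - L (L' x) + L y) \<partial>gauss \<partial>gauss)"
    by (subst nn_integral_gauss_pair) (simp_all add: borel_prod[symmetric])
  finally show ?thesis .
qed

lemma coisometry_uminus: "coisometry (\<lambda>y. - L y) (\<lambda>x. - L' x)"
  by (rule coisometry.intro) (auto simp: adjoint left_inverse linear_neg[OF linear_L']
      intro: linear_compose_neg linear_L linear_L')

lemma nn_integral_adjoint:
  assumes [measurable]: "h \<in> borel_measurable borel"
  shows "(\<integral>\<^sup>+x. h (L' x) \<partial>gauss) = (\<integral>\<^sup>+y. h y \<partial>gauss)"
proof -
  \<comment> \<open>The rotation puts \<open>- L' x\<close> into the second coordinate; negating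
    both maps removes the sign.\<close>
  interpret m: coisometry "\<lambda>y. - L y" "\<lambda>x. - L' x" by (rule coisometry_uminus)
  have "(\<integral>\<^sup>+y. h y \<partial>gauss) = (\<integral>\<^sup>+p. h (snd p) \<partial>(gauss :: ('v \<times> 'u) measure))"
    by (subst nn_integral_gauss_pair) 
       (simp_all add: borel_prod[symmetric] gauss.emeasure_space_1[simplified])
  also have "\<dots> = (\<integral>\<^sup>+p. h (L' (fst p)) \<partial>(gauss :: ('v \<times> 'u) measure))"
    by (subst m.nn_integral_rotate[symmetric]) (simp_all add: borel_prod[symmetric])
  also have "\<dots> = (\<integral>\<^sup>+x. h (L' x) \<partial>gauss)"
    by (subst nn_integral_gauss_pair) 
       (simp_all add: borel_prod[symmetric] gauss.emeasure_space_1[simplified])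
  finally show ?thesis ..
qed

lemma distr_adjoint: "distr gauss borel L' = gauss"
proof (rule measure_eqI)
  fix A assume "A \<in> sets (distr gauss borel L')"
  then have A [measurable]: "A \<in> sets borel" by simp
  have "emeasure (distr gauss borel L') A = (\<integral>\<^sup>+x. indicator A (L' x) \<partial>gauss)"
    by (simp add: emeasure_distr nn_integral_distr nn_integral_indicator[symmetric] del: nn_integral_indicator)
  also have "\<dots> = emeasure gauss A"
    by (subst nn_integral_adjoint) auto
  finally show "emeasure (distr gauss borel L') A = emeasure gauss A" .
qed simp

end

section \<open>Moments and Laplace transforms\<close>

lemma coisometry_inner:
  fixes b :: "'v::euclidean_space"
  assumes "norm b = 1"
  shows "coisometry (\<lambda>t. t *\<^sub>R b) (\<lambda>x. x \<bullet> b)"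
  using assms
  by (intro coisometry.intro)
     (auto simp: inner_add_left scaleR_add_left norm_eq_1 intro!: linearI)

lemma nn_integral_gauss_inner_square:
  fixes b :: "'v::euclidean_space"
  assumes "norm b = 1"
  shows "(\<integral>\<^sup>+x. ennreal ((x \<bullet> b)\<^sup>2) \<partial>gauss) = 1"
proof -
  interpret coisometry "\<lambda>t. t *\<^sub>R b" "\<lambda>x. x \<bullet> b"
    using assms by (rule coisometry_inner)
  have "(\<integral>\<^sup>+x. ennreal ((x \<bullet> b)\<^sup>2) \<partial>gauss) = (\<integral>\<^sup>+t. ennreal (t\<^sup>2) \<partial>(gauss :: real measure))"
    by (rule nn_integral_adjoint) simp
  also have "\<dots> = (\<integral>\<^sup>+t. ennreal (std_normal_density t * t\<^sup>2) \<partial>lborel)"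
    by (subst nn_integral_gauss) (simp_all add: gauss_density_def ennreal_mult'')
  also have "\<dots> = 1"
    using std_normal_moment_even[of 1]
    by (subst nn_integral_eq_integral) (auto simp: has_bochner_integral_iff fact_2)
  finally show ?thesis .
qed

lemma nn_integral_gauss_norm_square:
  "(\<integral>\<^sup>+x. ennreal ((norm x)\<^sup>2) \<partial>(gauss :: 'v::euclidean_space measure)) = of_nat DIM('v)"
proof -
  have "(\<integral>\<^sup>+x. ennreal ((norm x)\<^sup>2) \<partial>(gauss :: 'v measure)) =
      (\<integral>\<^sup>+x. (\<Sum>b\<in>Basis. ennreal ((x \<bullet> b)\<^sup>2)) \<partial>(gauss :: 'v measure))"
  proof (rule nn_integral_cong)
    fix x :: 'v
    have "(norm x)\<^sup>2 = (\<Sum>b\<in>Basis. (x \<bullet> b)\<^sup>2)"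
      by (subst power2_norm_eq_inner, subst euclidean_inner) (simp add: power2_eq_square)
    then show "ennreal ((norm x)\<^sup>2) = (\<Sum>b\<in>Basis. ennreal ((x \<bullet> b)\<^sup>2))" by simp
  qed
  also have "\<dots> = (\<Sum>b\<in>(Basis::'v set). \<integral>\<^sup>+x. ennreal ((x \<bullet> b)\<^sup>2) \<partial>gauss)"
    by (rule nn_integral_sum) simp
  also have "\<dots> = of_nat DIM('v)"
    by (simp add: nn_integral_gauss_inner_square)
  finally show ?thesis .
qed

lemma nn_integral_std_normal_exp:
  fixes s :: real
  assumes "0 \<le> s"
  shows "(\<integral>\<^sup>+t. ennreal (std_normal_density t * exp (- s * t\<^sup>2)) \<partial>lborel) =
    ennreal ((1 + 2 * s) powr (- 1 / 2))"
proof -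
  \<comment> \<open>The exponential tilt turns the standard normal density into \<open>c\<close>
    times the normal density with standard deviation \<open>c\<close>.\<close>
  define c where "c = 1 / sqrt (1 + 2 * s)"
  have pos: "0 < 1 + 2 * s" using assms by simp
  have c: "0 < c" "c\<^sup>2 = 1 / (1 + 2 * s)" 
    using pos by (simp_all add: c_def power_divide)
  have c_sqrt: "sqrt (2 * pi * c\<^sup>2) = c * sqrt (2 * pi)"
    using c(1) by (simp add: real_sqrt_mult mult.commute)
  have *: "std_normal_density t * exp (- s * t\<^sup>2) = c * normal_density 0 c t" for t
  proof -
    have "- t\<^sup>2 / 2 + - s * t\<^sup>2 = - t\<^sup>2 / (2 * c\<^sup>2)"
      using pos by (simp add: c field_simps)
    then have "exp (- t\<^sup>2 / 2) * exp (- s * t\<^sup>2) = exp (- t\<^sup>2 / (2 * c\<^sup>2))"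
      by (simp only: exp_add[symmetric])
    moreover have "c * (1 / (c * sqrt (2 * pi)) * E) = 1 / sqrt (2 * pi) * E" for E
      using c(1) by simp
    ultimately show ?thesis
      unfolding normal_density_def[of 0 c] std_normal_density_def c_sqrt diff_0_right
      by (simp only: mult.assoc)
  qed
  have "(\<integral>\<^sup>+t. ennreal (std_normal_density t * exp (- s * t\<^sup>2)) \<partial>lborel) =
      ennreal c * (\<integral>\<^sup>+t. ennreal (normal_density 0 c t) \<partial>lborel)"
    unfolding * using c by (simp add: ennreal_mult' nn_integral_cmult)
  also have "(\<integral>\<^sup>+t. ennreal (normal_density 0 c t) \<partial>lborel) = 1"
    using c by (subst nn_integral_eq_integral) auto
  also have "c = (1 + 2 * s) powr (- 1 / 2)"
    using pos powr_minus_divide[of "1 + 2 * s" "1 / 2"] by (simp add: c_def powr_half_sqrt)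
  finally show ?thesis by simp
qed

lemma nn_integral_gauss_exp_norm_square:
  fixes s :: real
  assumes "0 \<le> s"
  shows "(\<integral>\<^sup>+x. ennreal (exp (- s * (norm x)\<^sup>2)) \<partial>(gauss :: 'v::euclidean_space measure)) =
    ennreal ((1 + 2 * s) powr (- real DIM('v) / 2))"
proof -
  have "exp (- s * (norm x)\<^sup>2) = (\<Prod>b\<in>Basis. exp (- s * (x \<bullet> b)\<^sup>2))" for x :: 'v
    by (subst power2_norm_eq_inner, subst euclidean_inner)
       (simp add: power2_eq_square exp_sum[symmetric] sum_distrib_left)
  then have "(\<integral>\<^sup>+x. ennreal (exp (- s * (norm x)\<^sup>2)) \<partial>(gauss :: 'v measure)) =
      (\<integral>\<^sup>+x. ennreal (\<Prod>b\<in>Basis. exp (- s * (x \<bullet> b)\<^sup>2)) \<partial>(gauss :: 'v measure))"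
    by simp
  also have "\<dots> = (\<Prod>b\<in>(Basis :: 'v set). ennreal ((1 + 2 * s) powr (- 1 / 2)))"
    by (subst nn_integral_gauss_prod[where f = "\<lambda>b t. exp (- s * t\<^sup>2)"])
       (auto simp: nn_integral_std_normal_exp[OF assms, simplified])
  also have "\<dots> = ennreal ((1 + 2 * s) powr (- real DIM('v) / 2))"
    using assms by (simp add: prod_ennreal powr_power ennreal_power field_simps)
  finally show ?thesis .
qed

lemma nn_integral_exp_decay:
  fixes a :: real
  assumes "0 \<le> a"
  shows "(\<integral>\<^sup>+s. ennreal (exp (- s * a)) * indicator {0..} s \<partial>lborel) = inverse (ennreal a)"
proof (cases "a = 0")
  case True
  \<comment> \<open>For \<open>a = 0\<close> the integrand is 1 on a half-line of infinite length,
    matching \<open>inverse 0 = \<infinity>\<close>.\<close>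
  have "emeasure lborel {0::real..} = top"
  proof (rule ccontr)
    assume "emeasure lborel {0::real..} \<noteq> top"
    then obtain n where n: "emeasure lborel {0::real..} < of_nat n"
      using ennreal_Ex_less_of_nat by (auto simp: less_top)
    have "of_nat n = emeasure lborel {0..real n}" by (simp add: ennreal_of_nat_eq_real_of_nat)
    also have "\<dots> \<le> emeasure lborel {0::real..}" by (rule emeasure_mono) auto
    finally show False using n by simp
  qed
  with True show ?thesis by simp
next
  case False
  with assms have a: "0 < a" by simp
  have "((\<lambda>s. - exp (- s * a) / a) \<longlongrightarrow> 0) at_top"
    using a by real_asymp
  then have "(\<integral>\<^sup>+s. ennreal (exp (- s * a)) * indicator {0..} s \<partial>lborel) =
      ennreal (0 - (- exp (- 0 * a) / a))"
    using a by (intro nn_integral_FTC_atLeast) (auto intro!: derivative_eq_intros)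
  then show ?thesis using a by (simp add: inverse_ennreal divide_inverse)
qed

lemma nn_integral_powr_decay:
  fixes m :: real
  assumes "2 < m"
  shows "(\<integral>\<^sup>+s. ennreal ((1 + 2 * s) powr (- m / 2)) * indicator {0..} s \<partial>lborel) =
    ennreal (1 / (m - 2))"
proof -
  \<comment> \<open>This is the antiderivative of the integrand; its exponent is negative because
    \<open>m > 2\<close>.\<close>
  have lim: "((\<lambda>s. - 1 / (m - 2) * (1 + 2 * s) powr (1 - m / 2)) \<longlongrightarrow> 0) at_top"
    using assms by real_asymp
  have "(\<integral>\<^sup>+s. ennreal ((1 + 2 * s) powr (- m / 2)) * indicator {0..} s \<partial>lborel) =
      ennreal (0 - - 1 / (m - 2) * (1 + 2 * 0) powr (1 - m / 2))"
  proof (rule nn_integral_FTC_atLeast[OF _ _ _ lim])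
    fix s :: real assume "0 \<le> s"
    show "((\<lambda>s. - 1 / (m - 2) * (1 + 2 * s) powr (1 - m / 2)) has_real_derivative
        (1 + 2 * s) powr (- m / 2)) (at s)"
    proof -
      have "((\<lambda>s. (1 + 2 * s) powr (1 - m / 2)) has_real_derivative
          (1 - m / 2) * (1 + 2 * s) powr (1 - m / 2 - of_nat 1) * 2) (at s)"
        using \<open>0 \<le> s\<close> by (intro DERIV_fun_powr) (auto intro!: derivative_eq_intros)
      from DERIV_cmult[OF this, of "- 1 / (m - 2)"] show ?thesis
        by (rule DERIV_cong) (use assms in \<open>simp add: field_simps\<close>)
    qed
  qed auto
  then show ?thesis by simp
qed

text \<open>The identity \<open>1 / a = \<integral>\<^sub>0\<^sup>\<infinity> exp (- s a) ds\<close> turns a bound on the Laplace transform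
  into a bound on the inverse moment; it also holds for \<open>a = 0\<close> in \<^typ>\<open>ennreal\<close>.\<close>

lemma (in prob_space) inverse_moment_le:
  fixes N :: "'a \<Rightarrow> real" and m :: real
  assumes [measurable]: "N \<in> borel_measurable M" and nonneg: "\<And>x. 0 \<le> N x" and m: "2 < m"
    and le: "\<And>s. 0 \<le> s \<Longrightarrow> (\<integral>\<^sup>+x. ennreal (exp (- s * N x)) \<partial>M) \<le> ennreal ((1 + 2 * s) powr (- m / 2))"
  shows "(\<integral>\<^sup>+x. inverse (ennreal (N x)) \<partial>M) \<le> ennreal (1 / (m - 2))"
proof -
  interpret P: pair_sigma_finite M "lborel :: real measure" ..
  have "(\<integral>\<^sup>+x. inverse (ennreal (N x)) \<partial>M) =
      (\<integral>\<^sup>+x. \<integral>\<^sup>+s. ennreal (exp (- s * N x)) * indicator {0..} s \<partial>lborel \<partial>M)"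
    by (simp only: nn_integral_exp_decay[OF nonneg])
  also have "\<dots> = (\<integral>\<^sup>+s. \<integral>\<^sup>+x. ennreal (exp (- s * N x)) * indicator {0..} s \<partial>M \<partial>lborel)"
    by (rule P.Fubini'[symmetric]) measurable
  also have "\<dots> \<le> (\<integral>\<^sup>+s. ennreal ((1 + 2 * s) powr (- m / 2)) * indicator {0..} s \<partial>lborel)"
  proof (rule nn_integral_mono)
    fix s :: real
    show "(\<integral>\<^sup>+x. ennreal (exp (- s * N x)) * indicator {0..} s \<partial>M) \<le>
        ennreal ((1 + 2 * s) powr (- m / 2)) * indicator {0..} s"
      using le[of s] by (cases "0 \<le> s") auto
  qed
  also have "\<dots> = ennreal (1 / (m - 2))" by (rule nn_integral_powr_decay[OF m])
  finally show ?thesis .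
qed

section \<open>Standard normal matrices\<close>

lemma borel_measurable_vec_lambda [measurable (raw)]:
  fixes f :: "'i::finite \<Rightarrow> 'w \<Rightarrow> 'a::euclidean_space"
  assumes [measurable]: "\<And>i. f i \<in> borel_measurable M"
  shows "(\<lambda>x. \<chi> i. f i x) \<in> borel_measurable M"
proof (subst borel_measurable_euclidean_space, intro ballI)
  fix b :: "'a^'i" assume "b \<in> Basis"
  then obtain i c where "b = axis i c" by (auto simp: Basis_vec_def)
  then have "(\<lambda>x. (\<chi> i. f i x) \<bullet> b) = (\<lambda>x. f i x \<bullet> c)" by (simp add: inner_axis)
  then show "(\<lambda>x. (\<chi> i. f i x) \<bullet> b) \<in> borel_measurable M" by simp
qed

lemma borel_measurable_vec_nth [measurable (raw)]:
  fixes f :: "'w \<Rightarrow> 'a::topological_space^'i"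
  assumes "f \<in> borel_measurable M"
  shows "(\<lambda>x. f x $ i) \<in> borel_measurable M"
  using assms by (rule borel_measurable_continuous_on[rotated]) (intro continuous_intros)

text \<open>The coordinate vectors of \<open>X\<close> and of \<open>gauss\<close> have the same
  product law, and a vector is a measurable function of its coordinates. The free index set
  \<open>I\<close> lets pairs index the entries of a matrix.\<close>

lemma gauss_eq_distr_if_indep_vars:
  fixes X :: "'w \<Rightarrow> 'v::euclidean_space" and e :: "'i \<Rightarrow> 'v"
  assumes "prob_space M" and X [measurable]: "X \<in> borel_measurable M"
    and e: "bij_betw e I Basis"
    and indep: "prob_space.indep_vars M (\<lambda>_. borel) (\<lambda>i \<omega>. X \<omega> \<bullet> e i) I"
    and normal: "\<And>i. i \<in> I \<Longrightarrow> distributed M lborel (\<lambda>\<omega>. X \<omega> \<bullet> e i) std_normal_density"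
  shows "distr M borel X = gauss"
proof -
  interpret prob_space M by fact
  define N where "N = density lborel (\<lambda>t. ennreal (std_normal_density t))"
  have sets_N [measurable_cong, simp]: "sets N = sets borel" by (simp add: N_def)
  interpret N: prob_space N
    unfolding N_def by (rule prob_space_normal_density) simp
  have finite_I: "finite I" and I: "I \<noteq> {}"
    using bij_betw_finite[OF e] bij_betw_imp_surj_on[OF e] nonempty_Basis[where 'a = 'v] by (auto simp del: nonempty_Basis)
  interpret P: product_prob_space "\<lambda>_. N" I ..
  let ?P = "PiM I (\<lambda>_. borel :: real measure)"
  let ?C = "\<lambda>x. \<lambda>i\<in>I. x \<bullet> e i"
  have C [measurable]: "?C \<in> measurable borel ?P" by measurable
  have sets_P: "sets (PiM I (\<lambda>_. N)) = sets ?P" by (rule sets_PiM_cong) simp_all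
  have "distr M ?P (\<lambda>\<omega>. \<lambda>i\<in>I. X \<omega> \<bullet> e i) = PiM I (\<lambda>i. distr M borel (\<lambda>\<omega>. X \<omega> \<bullet> e i))"
    using indep I by (subst indep_vars_iff_distr_eq_PiM[symmetric]) auto
  also have "\<dots> = PiM I (\<lambda>_. N)"
  proof (rule PiM_cong)
    fix i assume "i \<in> I"
    have "distr M borel (\<lambda>\<omega>. X \<omega> \<bullet> e i) = distr M lborel (\<lambda>\<omega>. X \<omega> \<bullet> e i)"
      by (rule distr_cong) simp_all
    also have "\<dots> = N"
      unfolding N_def using normal[OF \<open>i \<in> I\<close>] by (rule distributed_distr_eq_density)
    finally show "distr M borel (\<lambda>\<omega>. X \<omega> \<bullet> e i) = N" .
  qed simp
  finally have law_X: "distr M ?P (\<lambda>\<omega>. ?C (X \<omega>)) = PiM I (\<lambda>_. N)" .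
  have law_gauss: "distr gauss ?P ?C = PiM I (\<lambda>_. N)"
  proof (rule P.PiM_eqI[OF finite_I])
    show "sets (distr gauss ?P ?C) = sets (PiM I (\<lambda>_. N))" by (simp add: sets_P)
  next
    fix A assume "\<And>i. i \<in> I \<Longrightarrow> A i \<in> sets N"
    then have A [measurable]: "\<And>i. i \<in> I \<Longrightarrow> A i \<in> sets borel" by simp
    \<comment> \<open>The sets \<open>A i\<close> are carried from \<open>I\<close> to
      \<open>Basis\<close> along \<open>e\<close>, so that the product formula for
      \<open>gauss\<close> applies to a rectangle.\<close>
    define f where "f b = (indicator (A (the_inv_into I e b)) :: real \<Rightarrow> real)" for b
    have [measurable]: "f b \<in> borel_measurable borel" if "b \<in> Basis" for b
      unfolding f_def using that e
      by (intro borel_measurable_indicator A) (metis bij_betw_def the_inv_into_into subset_refl)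
    have f_e: "f (e i) = indicator (A i)" if "i \<in> I" for i
      using that e by (simp add: f_def the_inv_into_f_f bij_betw_def)
    have "emeasure (distr gauss ?P ?C) (Pi\<^sub>E I A) = (\<integral>\<^sup>+x. indicator (Pi\<^sub>E I A) (?C x) \<partial>gauss)"
    proof -
      have [measurable]: "Pi\<^sub>E I A \<in> sets ?P" using finite_I by (intro sets_PiM_I_finite A)
      show ?thesis by (subst nn_integral_indicator[symmetric], simp, subst nn_integral_distr) simp_all
    qed
    also have "\<dots> = (\<integral>\<^sup>+x. ennreal (\<Prod>b\<in>Basis. f b (x \<bullet> b)) \<partial>gauss)"
    proof (rule nn_integral_cong)
      fix x :: 'v
      have "(\<Prod>b\<in>Basis. f b (x \<bullet> b)) = (\<Prod>i\<in>I. f (e i) (x \<bullet> e i))"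
        by (rule prod.reindex_bij_betw[OF e, of "\<lambda>b. f b (x \<bullet> b)", symmetric])
      also have "\<dots> = (\<Prod>i\<in>I. indicator (A i) (x \<bullet> e i))" by (simp add: f_e)
      also have "\<dots> = indicator (Pi\<^sub>E I A) (?C x)"
        using finite_I by (auto simp: indicator_def PiE_iff)
      finally show "indicator (Pi\<^sub>E I A) (?C x) = ennreal (\<Prod>b\<in>Basis. f b (x \<bullet> b))"
        by (simp add: indicator_def)
    qed
    also have "\<dots> = (\<Prod>b\<in>(Basis::'v set). \<integral>\<^sup>+t. ennreal (std_normal_density t * f b t) \<partial>lborel)"
      by (rule nn_integral_gauss_prod) (measurable, simp add: f_def)
    also have "\<dots> = (\<Prod>i\<in>I. \<integral>\<^sup>+t. ennreal (std_normal_density t * f (e i) t) \<partial>lborel)"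
      by (rule prod.reindex_bij_betw[OF e, symmetric])
    also have "\<dots> = (\<Prod>i\<in>I. emeasure N (A i))"
      by (intro prod.cong refl)
         (simp add: f_e N_def emeasure_density ennreal_mult'' ennreal_indicator)
    finally show "emeasure (distr gauss ?P ?C) (Pi\<^sub>E I A) = (\<Prod>i\<in>I. emeasure N (A i))" .
  qed
  \<comment> \<open>\<open>?S\<close> reassembles a vector from its coordinates and thus inverts
    \<open>?C\<close>.\<close>
  let ?S = "\<lambda>f. \<Sum>i\<in>I. f i *\<^sub>R e i"
  have S [measurable]: "?S \<in> borel_measurable ?P" by measurable
  have SC: "(\<Sum>i\<in>I. (x \<bullet> e i) *\<^sub>R e i) = x" for x :: 'v
    using euclidean_representation[of x] sum.reindex_bij_betw[OF e, of "\<lambda>b. (x \<bullet> b) *\<^sub>R b"]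
    by simp
  have "distr M borel X = distr (distr M ?P (\<lambda>\<omega>. ?C (X \<omega>))) borel ?S"
    by (subst distr_distr) (simp_all add: comp_def SC)
  also have "\<dots> = distr (distr gauss ?P ?C) borel ?S" by (simp only: law_X law_gauss)
  also have "\<dots> = gauss"
    by (subst distr_distr) (simp_all add: comp_def SC distr_id2)
  finally show ?thesis .
qed

text \<open>A product of sigma-finite measures is determined by rectangles, on which independence is
  the product rule.\<close>

lemma distr_pair_if_indep_rv:
  fixes X :: "'w \<Rightarrow> 'b::second_countable_topology" and Y :: "'w \<Rightarrow> 'c::second_countable_topology"
  assumes "prob_space M" and indep: "indep_rv M X Y"
  shows "distr M borel (\<lambda>\<omega>. (X \<omega>, Y \<omega>)) = distr M borel X \<Otimes>\<^sub>M distr M borel Y"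
proof -
  interpret prob_space M by fact
  have [measurable]: "X \<in> borel_measurable M" "Y \<in> borel_measurable M"
    using indep by (auto simp: indep_rv_def)
  interpret X: prob_space "distr M borel X" by (rule prob_space_distr) simp
  interpret Y: prob_space "distr M borel Y" by (rule prob_space_distr) simp
  show ?thesis
  proof (rule pair_measure_eqI[symmetric])
    show "sets (distr M borel X \<Otimes>\<^sub>M distr M borel Y) = sets (distr M borel (\<lambda>\<omega>. (X \<omega>, Y \<omega>)))"
      by (simp add: borel_prod[symmetric] cong: sets_pair_measure_cong)
  next
    fix A B assume "A \<in> sets (distr M borel X)" "B \<in> sets (distr M borel Y)"
    then have [measurable]: "A \<in> sets borel" "B \<in> sets borel" by auto
    have "A \<times> B \<in> sets (borel \<Otimes>\<^sub>M borel)" by simp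
    then have [measurable]: "A \<times> B \<in> sets borel" by (simp only: borel_prod)
    have "(\<lambda>\<omega>. (X \<omega>, Y \<omega>)) -` (A \<times> B) \<inter> space M = (X -` A \<inter> space M) \<inter> (Y -` B \<inter> space M)"
      by auto
    moreover have "prob ((X -` A \<inter> space M) \<inter> (Y -` B \<inter> space M)) =
        prob (X -` A \<inter> space M) * prob (Y -` B \<inter> space M)"
      using indep unfolding indep_rv_def by (intro indep_setD) auto
    moreover have [measurable]: "(\<lambda>\<omega>. (X \<omega>, Y \<omega>)) \<in> borel_measurable M" by measurable
    ultimately show "emeasure (distr M borel X) A * emeasure (distr M borel Y) B =
        emeasure (distr M borel (\<lambda>\<omega>. (X \<omega>, Y \<omega>))) (A \<times> B)"
      by (simp add: emeasure_distr emeasure_eq_measure ennreal_mult'')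
  qed (auto intro: X.sigma_finite_measure_axioms Y.sigma_finite_measure_axioms)
qed

lemma real_std_normal_measurable:
  fixes G :: "'w \<Rightarrow> real^'n^'m"
  assumes "real_std_normal M G"
  shows "G \<in> borel_measurable M"
proof -
  have "(\<lambda>\<omega>. G \<omega> $ i $ j) \<in> borel_measurable M" for i j
    using assms distributed_measurable[of M lborel "\<lambda>\<omega>. G \<omega> $ i $ j" std_normal_density]
    by (simp add: real_std_normal_def)
  then have "(\<lambda>\<omega>. \<chi> i j. G \<omega> $ i $ j) \<in> borel_measurable M"
    by (intro borel_measurable_vec_lambda)
  then show ?thesis by simp
qed

lemma distr_real_std_normal:
  fixes G :: "'w \<Rightarrow> real^'n^'m"
  assumes "prob_space M" "real_std_normal M G"
  shows "distr M borel G = gauss"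
proof (rule gauss_eq_distr_if_indep_vars[where I = UNIV and e = "\<lambda>(i, j). axis i (axis j 1)"])
  show "bij_betw (\<lambda>(i, j). axis i (axis j 1)) UNIV (Basis :: (real^'n^'m) set)"
    by (auto simp: bij_betw_def inj_on_def axis_eq_axis Basis_vec_def)
  show "prob_space.indep_vars M (\<lambda>_. borel) (\<lambda>p \<omega>. G \<omega> \<bullet> (\<lambda>(i, j). axis i (axis j 1)) p) UNIV"
    using assms(2) by (simp add: real_std_normal_def inner_axis case_prod_unfold)
  show "distributed M lborel (\<lambda>\<omega>. G \<omega> \<bullet> (\<lambda>(i, j). axis i (axis j 1)) p) std_normal_density" for p
    using assms(2) by (simp add: real_std_normal_def inner_axis case_prod_unfold)
qed (use assms real_std_normal_measurable in auto)

lemma distr_indep_gauss: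
  fixes X :: "'w \<Rightarrow> 'b::euclidean_space" and Y :: "'w \<Rightarrow> 'c::euclidean_space"
  assumes "prob_space M" "indep_rv M X Y" "distr M borel X = gauss" "distr M borel Y = gauss"
  shows "distr M borel (\<lambda>\<omega>. (X \<omega>, Y \<omega>)) = gauss"
  using distr_pair_if_indep_rv[OF assms(1,2)] assms(3,4) by (simp add: gauss_pair_measure)

lemma distr_complex_std_normal:
  fixes G :: "'w \<Rightarrow> complex^'n^'m"
  assumes "prob_space M" "complex_std_normal M G"
  shows "distr M borel G = gauss"
proof -
  obtain G1 G2 where G: "real_std_normal M G1" "real_std_normal M G2" "indep_rv M G1 G2"
    and entries: "\<And>\<omega> i j. \<omega> \<in> space M \<Longrightarrow> G \<omega> $ i $ j = Complex (G1 \<omega> $ i $ j) (G2 \<omega> $ i $ j)"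
    using assms(2) by (auto simp: complex_std_normal_def)
  have [measurable]: "G1 \<in> borel_measurable M" "G2 \<in> borel_measurable M"
    using G by (auto intro: real_std_normal_measurable)
  \<comment> \<open>Splitting into real and imaginary parts is an isometry of real Euclidean spaces,
    so \<open>distr_adjoint\<close> transports the law of the pair to the complex matrix.\<close>
  let ?L = "\<lambda>C :: complex^'n^'m. ((\<chi> i j. Re (C $ i $ j)) :: real^'n^'m, (\<chi> i j. Im (C $ i $ j)) :: real^'n^'m)"
  let ?L' = "\<lambda>p :: (real^'n^'m) \<times> (real^'n^'m). (\<chi> i j. Complex (fst p $ i $ j) (snd p $ i $ j)) :: complex^'n^'m"
  interpret coisometry ?L ?L'
    by (rule coisometry.intro)
       (auto intro!: linearI simp: vec_eq_iff complex_eq_iff inner_vec_def inner_complex_def sum.distrib)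
  have joint: "distr M borel (\<lambda>\<omega>. (G1 \<omega>, G2 \<omega>)) = gauss"
    using assms(1) G by (intro distr_indep_gauss distr_real_std_normal)
  have "(\<lambda>\<omega>. (G1 \<omega>, G2 \<omega>)) \<in> borel_measurable M" by measurable
  then have "distr M borel (\<lambda>\<omega>. ?L' (G1 \<omega>, G2 \<omega>)) = distr (distr M borel (\<lambda>\<omega>. (G1 \<omega>, G2 \<omega>))) borel ?L'"
    by (subst distr_distr) (auto simp: comp_def intro: L'_measurable)
  also have "\<dots> = gauss" unfolding joint by (rule distr_adjoint)
  finally have "distr M borel (\<lambda>\<omega>. ?L' (G1 \<omega>, G2 \<omega>)) = gauss" .
  moreover have "distr M borel G = distr M borel (\<lambda>\<omega>. ?L' (G1 \<omega>, G2 \<omega>))"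
    by (rule distr_cong) (simp_all add: vec_eq_iff entries)
  ultimately show ?thesis by simp
qed

section \<open>Hermitian inner product and Gram--Schmidt residuals\<close>

text \<open>The common theory of \<^typ>\<open>real\<close> and \<^typ>\<open>complex\<close>: the field enters through its real dimension
  \<open>d\<close> only, and the parameter of the error bound is \<open>\<alpha> = 2 / d - 1\<close>.\<close>

class hermitian_field = real_normed_field + euclidean_space + conjugatable_field +
  assumes inner_eq_mult_conjugate: "x \<bullet> y = 1 \<bullet> (x * conjugate y)"
    and mult_conjugate_eq_scaleR: "x * conjugate x = (norm x)\<^sup>2 *\<^sub>R 1"
    and conjugate_scaleR: "conjugate (r *\<^sub>R x) = r *\<^sub>R conjugate x"

instance real :: hermitian_field
  by standard (auto simp: power2_eq_square)

instance complex :: hermitian_field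
  by standard (auto simp: inner_complex_def complex_norm_square[symmetric] scaleR_conv_of_real)

lemma mult_conjugate_self: "x * conjugate x = of_real ((norm x)\<^sup>2)" for x :: "'a::hermitian_field"
  by (simp add: mult_conjugate_eq_scaleR of_real_def)

lemma conjugate_one [simp]: "conjugate (1::'a::hermitian_field) = 1"
  using mult_conjugate_self[of "1::'a"] by simp

lemma conjugate_diff: "conjugate (x - y :: 'a::conjugatable_ring) = conjugate x - conjugate y"
  using conjugate_dist_add[of x "- y"] by (simp add: conjugate_neg)

lemma norm_conjugate [simp]: "norm (conjugate (x::'a::hermitian_field)) = norm x"
proof -
  have "of_real ((norm (conjugate x))\<^sup>2) = (of_real ((norm x)\<^sup>2) :: 'a)"
    using mult_conjugate_self[of x] mult_conjugate_self[of "conjugate x"] by (simp add: mult.commute)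
  then show ?thesis by (simp only: of_real_eq_iff) simp
qed

lemma inner_conjugate_conjugate: "conjugate x \<bullet> conjugate y = x \<bullet> (y::'a::hermitian_field)"
proof -
  have "conjugate x \<bullet> conjugate y = y \<bullet> x"
    by (simp add: inner_eq_mult_conjugate[of "conjugate x"] inner_eq_mult_conjugate[of y x] mult.commute)
  then show ?thesis by (simp add: inner_commute)
qed

lemma linear_conjugate: "linear (conjugate :: 'a::hermitian_field \<Rightarrow> 'a)"
  by (intro linearI) (simp_all add: conjugate_dist_add conjugate_scaleR)

lemma conjugate_measurable [measurable]: "(conjugate :: 'a::hermitian_field \<Rightarrow> 'a) \<in> borel_measurable borel"
  by (rule measurable_linear[OF linear_conjugate])

text \<open>Linear in the first argument and conjugate linear in the second; the real inner product
  is its real part \<open>1 \<bullet> cip x y\<close>.\<close>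

definition cip :: "'a::hermitian_field^'n \<Rightarrow> 'a^'n \<Rightarrow> 'a" where
  "cip x y = (\<Sum>i\<in>UNIV. x $ i * conjugate (y $ i))"

lemma cip_add_left: "cip (x + y) z = cip x z + cip y z"
  and cip_diff_left: "cip (x - y) z = cip x z - cip y z"
  and cip_scale_left: "cip (c *s x) z = c * cip x z"
  and cip_scaleR_left: "cip (r *\<^sub>R x) z = r *\<^sub>R cip x z"
  and cip_zero_left [simp]: "cip 0 z = 0"
  by (simp_all add: cip_def algebra_simps sum.distrib sum_subtractf sum_distrib_left scaleR_sum_right)

lemma conjugate_cip: "conjugate (cip x y) = cip y x"
  by (simp add: cip_def sum_conjugate conjugate_dist_mul mult.commute)

lemma cip_add_right: "cip z (x + y) = cip z x + cip z y"
  and cip_diff_right: "cip z (x - y) = cip z x - cip z y"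
  and cip_scale_right: "cip z (c *s x) = conjugate c * cip z x"
  and cip_scaleR_right: "cip z (r *\<^sub>R x) = r *\<^sub>R cip z x"
  and cip_zero_right [simp]: "cip z 0 = 0"
  by (simp_all add: conjugate_cip[symmetric, of z] cip_add_left cip_diff_left cip_scale_left
      cip_scaleR_left conjugate_scaleR conjugate_dist_add conjugate_diff conjugate_dist_mul)

lemma cip_sum_left: "cip (\<Sum>i\<in>I. f i) z = (\<Sum>i\<in>I. cip (f i) z)"
  by (induction I rule: infinite_finite_induct) (simp_all add: cip_add_left)

lemma cip_sum_right: "cip z (\<Sum>i\<in>I. f i) = (\<Sum>i\<in>I. cip z (f i))"
  by (induction I rule: infinite_finite_induct) (simp_all add: cip_add_right)

lemma cip_commute_zero: "cip x y = 0 \<longleftrightarrow> cip y x = 0"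
  by (metis conjugate_cip conjugate_zero)

lemma inner_eq_cip: "x \<bullet> y = 1 \<bullet> cip x y"
  by (simp add: inner_vec_def cip_def inner_sum_right inner_eq_mult_conjugate[symmetric])

lemma cip_self: "cip x x = of_real ((norm x)\<^sup>2)"
  by (simp add: cip_def mult_conjugate_self norm_vec_def L2_set_def sum_nonneg)

lemma cip_self_eq_0_iff [simp]: "cip x x = 0 \<longleftrightarrow> x = 0"
  by (simp add: cip_self)

lemma norm_scale_vec: "norm (c *s x :: 'a::hermitian_field^'n) = norm c * norm x"
  by (simp add: norm_vec_def norm_mult L2_set_right_distrib)

lemma norm_add_square_orthogonal:
  assumes "cip x y = 0"
  shows "(norm (x + y))\<^sup>2 = (norm x)\<^sup>2 + (norm y)\<^sup>2"
  using assms by (intro norm_add_Pythagorean) (simp add: orthogonal_def inner_eq_cip)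

lemma norm_diff_square_orthogonal:
  assumes "cip x y = 0"
  shows "(norm (x - y))\<^sup>2 = (norm x)\<^sup>2 + (norm y)\<^sup>2"
  using norm_add_square_orthogonal[of x "- y"] assms cip_diff_right[of x 0 y] by simp

lemma cip_measurable [measurable (raw)]:
  fixes f g :: "'w \<Rightarrow> 'a::hermitian_field^'n"
  assumes [measurable]: "f \<in> borel_measurable M" "g \<in> borel_measurable M"
  shows "(\<lambda>x. cip (f x) (g x)) \<in> borel_measurable M"
  unfolding cip_def by measurable

lemma scale_vec_measurable [measurable (raw)]:
  fixes f :: "'w \<Rightarrow> 'a::hermitian_field" and g :: "'w \<Rightarrow> 'a^'n"
  assumes [measurable]: "f \<in> borel_measurable M" "g \<in> borel_measurable M"
  shows "(\<lambda>x. f x *s g x) \<in> borel_measurable M"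
  unfolding vector_scalar_mult_def by measurable

text \<open>\<open>resid g js y\<close> is the component of \<open>y\<close> orthogonal to all \<open>g j\<close> with \<open>j\<close> in \<open>js\<close>,
  computed by the Gram--Schmidt process. If \<open>g j\<close> depends linearly on the later vectors in the list, then
  \<open>w = 0\<close>, and the correction vanishes because \<open>0 / 0 = 0\<close>.\<close>

primrec resid :: "('i \<Rightarrow> 'a::hermitian_field^'n) \<Rightarrow> 'i list \<Rightarrow> 'a^'n \<Rightarrow> 'a^'n" where
  "resid g [] y = y"
| "resid g (j # js) y = resid g js y -
     (cip (resid g js y) (resid g js (g j)) / cip (resid g js (g j)) (resid g js (g j))) *s resid g js (g j)"

lemma resid_cong: "(\<And>j. j \<in> set js \<Longrightarrow> g j = g' j) \<Longrightarrow> resid g js y = resid g' js y"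
  by (induction js arbitrary: y) simp_all

lemma resid_measurable [measurable (raw)]:
  fixes g :: "'w \<Rightarrow> 'i \<Rightarrow> 'a::hermitian_field^'n"
  assumes [measurable]: "\<And>j. (\<lambda>x. g x j) \<in> borel_measurable M" "y \<in> borel_measurable M"
  shows "(\<lambda>x. resid (g x) js (y x)) \<in> borel_measurable M"
  using assms(2)
proof (induction js arbitrary: y)
  case (Cons j js)
  note [measurable] = Cons.IH[OF Cons.prems] Cons.IH[OF assms(1)[of j]]
  show ?case unfolding resid.simps by measurable
qed simp

lemma resid_add: "resid g js (x + y) = resid g js x + resid g js y"
  by (induction js arbitrary: x y)
     (simp_all add: cip_add_left add_divide_distrib vec.scale_left_distrib algebra_simps)

lemma resid_scale: "resid g js (c *s x) = c *s resid g js x"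
  by (induction js arbitrary: x)
     (simp_all add: cip_scale_left vec.scale_right_diff_distrib)

lemma resid_diff: "resid g js (x - y) = resid g js x - resid g js y"
  using resid_add[of g js "x - y" y] by (simp add: eq_diff_eq)

lemma cip_gram_schmidt_step [simp]: "cip (z - (cip z w / cip w w) *s w) w = 0"
  by (cases "w = 0") (simp_all add: cip_diff_left cip_scale_left)

text \<open>Together with \<open>cip_resid_left\<close> this makes \<open>resid g js\<close> an
  orthogonal projection. A residual is fixed by the projection for the tail of the list and is
  orthogonal to the last direction removed, so a second pass changes nothing.\<close>

lemma resid_idem [simp]: "resid g js (resid g js x) = resid g js x"
proof (induction js arbitrary: x)
  case (Cons j js)
  let ?w = "resid g js (g j)"
  have "resid g js (resid g (j # js) x) = resid g (j # js) x"
    by (simp add: resid_diff resid_scale Cons.IH)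
  then show ?case by (subst resid.simps) simp
qed simp

lemma cip_resid_left: "cip (resid g js x) y = cip x (resid g js y)"
proof (induction js arbitrary: x y)
  case (Cons j js)
  let ?R = "resid g js" and ?w = "resid g js (g j)"
  have w: "cip ?w y = cip ?w (?R y)" "cip (?R x) ?w = cip x ?w"
    using Cons.IH[of ?w y] Cons.IH[of x ?w] by simp_all
  have "conjugate (cip ?w ?w) = cip ?w ?w" by (rule conjugate_cip)
  \<comment> \<open>The case \<open>b = 0\<close> matters: it covers a vanishing Gram--Schmidt
    direction, where the quotient is 0 by default.\<close>
  moreover have "conjugate (a / b) = conjugate a / conjugate b" for a b :: 'a
    by (cases "b = 0", simp, metis conjugate_dist_mul conjugate_zero_iff nonzero_eq_divide_eq)
  ultimately have "conjugate (cip (?R y) ?w / cip ?w ?w) = cip ?w (?R y) / cip ?w ?w"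
    by (simp add: conjugate_cip)
  then show ?case
    by (simp add: cip_diff_left cip_diff_right cip_scale_left cip_scale_right Cons.IH w(2) w(1)[symmetric])
qed simp

lemma resid_generator: "j \<in> set js \<Longrightarrow> resid g js (g j) = 0"
proof (induction js)
  case (Cons i js)
  show ?case
  proof (cases "j \<in> set js")
    case True
    then show ?thesis by (simp add: Cons.IH)
  next
    case False
    with Cons.prems have "j = i" by simp
    \<comment> \<open>The step subtracts from this vector its projection onto itself.\<close>
    then show ?thesis by (cases "resid g js (g i) = 0") simp_all
  qed
qed simp

lemma cip_resid_generator: "j \<in> set js \<Longrightarrow> cip (resid g js x) (g j) = 0"
  by (simp add: cip_resid_left resid_generator)

lemma cip_resid_self: "cip x (resid g js x) = of_real ((norm (resid g js x))\<^sup>2)"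
  by (metis cip_resid_left cip_self resid_idem)

lemma resid_orthogonal:
  assumes "\<And>j. j \<in> set js \<Longrightarrow> cip z (g j) = 0"
  shows "resid g js z = z"
  using assms
proof (induction js)
  case (Cons j js)
  then have "resid g js z = z" by simp
  then have "cip z (resid g js (g j)) = 0"
    using Cons.prems[of j] by (simp add: cip_resid_left[symmetric])
  with \<open>resid g js z = z\<close> show ?case by simp
qed simp

section \<open>Inverse moments of residuals\<close>

text \<open>Resampling along one direction over the field replaces \<open>DIM('a)\<close> real
  coordinates at once.\<close>

lemma coisometry_cip:
  fixes b :: "'a::hermitian_field^'n"
  assumes "norm b = 1"
  shows "coisometry (\<lambda>z. z *s b) (\<lambda>y. cip y b)"
proof (rule coisometry.intro)
  show "linear (\<lambda>z. z *s b)"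
    by (intro linearI) (simp_all add: vec.scale_left_distrib vec_eq_iff)
  show "linear (\<lambda>y. cip y b)"
    by (intro linearI) (simp_all add: cip_add_left cip_scaleR_left)
  show "x \<bullet> (z *s b) = cip x b \<bullet> z" for x z
    by (simp add: inner_eq_cip cip_scale_right inner_eq_mult_conjugate[of _ z] mult.commute)
  show "cip (z *s b) b = z" for z
    using assms by (simp add: cip_scale_left cip_self)
qed

lemma nn_integral_gauss_cip:
  fixes b :: "'a::hermitian_field^'n"
  shows "(\<integral>\<^sup>+y. ennreal ((norm (cip y b))\<^sup>2) \<partial>gauss) = ennreal (real DIM('a) * (norm b)\<^sup>2)"
proof (cases "b = 0")
  case False
  define u where "u = of_real (1 / norm b) *s b"
  have u: "norm u = 1" using False by (simp add: u_def norm_scale_vec norm_divide)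
  interpret coisometry "\<lambda>z. z *s u" "\<lambda>y. cip y u" using u by (rule coisometry_cip)
  have b: "b = of_real (norm b) *s u" using False by (simp add: u_def)
  have "(norm (cip y b))\<^sup>2 = (norm b)\<^sup>2 * (norm (cip y u))\<^sup>2" for y
    by (subst b) (simp add: cip_scale_right norm_mult power_mult_distrib)
  then have "(\<integral>\<^sup>+y. ennreal ((norm (cip y b))\<^sup>2) \<partial>gauss) =
      ennreal ((norm b)\<^sup>2) * (\<integral>\<^sup>+y. ennreal ((norm (cip y u))\<^sup>2) \<partial>gauss)"
    by (simp add: ennreal_mult'' nn_integral_cmult)
  also have "(\<integral>\<^sup>+y. ennreal ((norm (cip y u))\<^sup>2) \<partial>gauss) = (\<integral>\<^sup>+z. ennreal ((norm z)\<^sup>2) \<partial>(gauss :: 'a measure))"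
    by (rule nn_integral_adjoint) simp
  also have "\<dots> = of_nat DIM('a)" by (rule nn_integral_gauss_norm_square)
  finally show ?thesis by (simp add: ennreal_mult'' ennreal_of_nat_eq_real_of_nat mult.commute)
qed simp

text \<open>Each Gram--Schmidt step removes at most \<open>DIM('a)\<close> real Gaussian
  coordinates, and each such coordinate contributes a factor
  \<open>(1 + 2 * s) powr (- 1 / 2)\<close>. Linear dependence among the \<open>g j\<close> only
  keeps more coordinates, hence an inequality.\<close>

lemma nn_integral_exp_resid:
  fixes g :: "'i \<Rightarrow> 'a::hermitian_field^'l" and s :: real
  assumes s: "0 \<le> s"
  shows "(\<integral>\<^sup>+y. ennreal (exp (- s * (norm (resid g js y))\<^sup>2)) \<partial>gauss) \<le>
    ennreal ((1 + 2 * s) powr (- (real DIM('a) * (real CARD('l) - real (length js))) / 2))"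
proof (induction js)
  case Nil
  show ?case using nn_integral_gauss_exp_norm_square[OF s, where 'v = "'a^'l"] by (simp add: mult.commute)
next
  case (Cons j js)
  let ?c = "1 + 2 * s" and ?v = "real DIM('a)"
  let ?E = "\<lambda>js. \<integral>\<^sup>+y. ennreal (exp (- s * (norm (resid g js y))\<^sup>2)) \<partial>gauss"
  let ?q = "\<lambda>n. - (?v * (real CARD('l) - n)) / 2"
  define w where "w = resid g js (g j)"
  have c: "1 \<le> ?c" using s by simp
  have "?E (j # js) \<le> ?E js * ennreal (?c powr (?v / 2))"
  proof (cases "w = 0")
    \<comment> \<open>A dependent direction removes nothing, while the allowed factor is at least
      1.\<close>
    case True
    then have "?E (j # js) = ?E js * 1" by (simp add: w_def)
    also have "\<dots> \<le> ?E js * ennreal (?c powr (?v / 2))"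
      using c by (intro mult_left_mono) (auto simp: ge_one_powr_ge_zero)
    finally show ?thesis .
  next
    case False
    define b where "b = of_real (1 / norm w) *s w"
    have b: "norm b = 1" using False by (simp add: b_def norm_scale_vec norm_divide)
    interpret coisometry "\<lambda>z. z *s b" "\<lambda>y. cip y b" using b by (rule coisometry_cip)
    have w: "w = of_real (norm w) *s b" using False by (simp add: b_def)
    have Rb: "resid g js b = b" by (simp add: b_def resid_scale w_def)
    have step: "resid g (j # js) y = resid g js y - cip y b *s b" for y
    proof -
      have "cip (resid g js y) b = cip y b" by (simp add: cip_resid_left Rb)
      then have "(cip (resid g js y) w / cip w w) *s w = cip y b *s b"
        using False by (subst (1 2 3 4) w) (simp add: cip_scale_left cip_scale_right conjugate_cip
          cip_self[of b] b mult_conjugate_self)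
      then show ?thesis by (simp add: w_def)
    qed
    have R'b: "resid g (j # js) b = 0" by (simp only: step Rb cip_self b) simp
    have pyth: "(norm (resid g js y))\<^sup>2 = (norm (resid g (j # js) y))\<^sup>2 + (norm (cip y b))\<^sup>2" for y
    proof -
      have "cip (resid g (j # js) y) (cip y b *s b) = 0"
        by (simp only: cip_resid_left resid_scale R'b vec.scale_zero_right cip_zero_right)
      from norm_add_square_orthogonal[OF this] show ?thesis
        unfolding step by (simp add: norm_scale_vec b)
    qed
    have "?E js = (\<integral>\<^sup>+y. ennreal (exp (- s * (norm (resid g (j # js) y))\<^sup>2)) *
        ennreal (exp (- s * (norm (cip y b))\<^sup>2)) \<partial>gauss)"
      by (intro nn_integral_cong) (simp add: pyth ennreal_mult'[symmetric] exp_add[symmetric] algebra_simps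
           del: resid.simps)
    \<comment> \<open>Resampling along \<open>b\<close> leaves the new residual unchanged, as it
      annihilates \<open>b\<close>, and turns \<open>cip y b\<close> into a fresh \<open>z\<close>;
      the integral then factorizes.\<close>
    also have "\<dots> = (\<integral>\<^sup>+y. \<integral>\<^sup>+z. ennreal (exp (- s * (norm (resid g (j # js) y))\<^sup>2)) *
        ennreal (exp (- s * (norm z)\<^sup>2)) \<partial>(gauss :: 'a measure) \<partial>gauss)"
      by (subst nn_integral_resample)
         (auto simp del: resid.simps simp: resid_add resid_diff resid_scale R'b cip_add_left cip_diff_left
             cip_scale_left cip_self b)
    also have "\<dots> = ?E (j # js) * ennreal (?c powr (- ?v / 2))"
      by (simp add: nn_integral_cmult nn_integral_multc nn_integral_gauss_exp_norm_square[OF s, simplified] 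
         del: resid.simps)
    finally have "?E js * ennreal (?c powr (?v / 2)) =
        ?E (j # js) * (ennreal (?c powr (- ?v / 2)) * ennreal (?c powr (?v / 2)))"
      by (simp only: mult.assoc)
    also have "ennreal (?c powr (- ?v / 2)) * ennreal (?c powr (?v / 2)) = 1"
      using c by (simp add: ennreal_mult'[symmetric] powr_add[symmetric])
    finally show ?thesis by simp
  qed
  also have "\<dots> \<le> ennreal (?c powr ?q (length js)) * ennreal (?c powr (?v / 2))"
    by (intro mult_right_mono Cons.IH) simp
  also have "\<dots> = ennreal (?c powr (?q (length js) + ?v / 2))"
    by (subst powr_add) (simp add: ennreal_mult')
  also have "?q (length js) + ?v / 2 = ?q (length (j # js))"
    by (simp add: field_simps)
  finally show ?case .
qed

lemma nn_integral_inverse_resid: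
  fixes g :: "'i \<Rightarrow> 'a::hermitian_field^'l"
  assumes "2 < real DIM('a) * (real CARD('l) - real (length js))"
  shows "(\<integral>\<^sup>+y. inverse (ennreal ((norm (resid g js y))\<^sup>2)) \<partial>gauss) \<le>
    ennreal (1 / (real DIM('a) * (real CARD('l) - real (length js)) - 2))"
  using assms by (intro gauss.inverse_moment_le nn_integral_exp_resid) auto

text \<open>This allows \<open>G *v v\<close> to be resampled for a unit vector \<open>v\<close>; by
  \<open>outer_mult_vec\<close>, \<open>G *v u\<close> is unaffected for every \<open>u\<close>
  orthogonal to \<open>v\<close>.\<close>

lemma coisometry_outer:
  fixes v :: "'a::hermitian_field^'n"
  assumes "norm v = 1"
  shows "coisometry (\<lambda>y. (\<chi> i j. y $ i * conjugate (v $ j)) :: 'a^'n^'l) (\<lambda>G. G *v v)"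
proof (rule coisometry.intro)
  show "linear (\<lambda>y. (\<chi> i j. y $ i * conjugate (v $ j)) :: 'a^'n^'l)"
    by (intro linearI) (simp_all add: vec_eq_iff algebra_simps)
  show "linear (\<lambda>G :: 'a^'n^'l. G *v v)"
    by (intro linearI) (simp_all add: vec_eq_iff matrix_vector_mult_def algebra_simps sum.distrib scaleR_sum_right)
  have "a \<bullet> (b * conjugate c) = (a * c) \<bullet> b" for a b c :: 'a
    by (simp add: inner_eq_mult_conjugate[of a] inner_eq_mult_conjugate[of "a * c"] conjugate_dist_mul mult_ac)
  then show "G \<bullet> (\<chi> i j. y $ i * conjugate (v $ j)) = (G *v v) \<bullet> y" for G :: "'a^'n^'l" and y
    by (simp add: inner_vec_def matrix_vector_mult_def inner_sum_left)
  show "(\<chi> i j. y $ i * conjugate (v $ j)) *v v = y" for y :: "'a^'l"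
  proof -
    have "(\<Sum>j\<in>UNIV. v $ j * conjugate (v $ j)) = 1"
      using cip_self[of v] assms by (simp add: cip_def)
    then show ?thesis
      by (simp add: vec_eq_iff matrix_vector_mult_def mult.assoc mult.commute[of "conjugate _"] 
         sum_distrib_left[symmetric])
  qed
qed

lemma outer_mult_vec:
  fixes y :: "'a::hermitian_field^'l"
  shows "(\<chi> i j. y $ i * conjugate (v $ j)) *v u = cip u v *s y"
  by (simp add: vec_eq_iff matrix_vector_mult_def cip_def sum_distrib_left sum_distrib_right mult_ac)

lemma matrix_vector_measurable [measurable (raw)]:
  fixes G :: "'w \<Rightarrow> 'a::hermitian_field^'n^'l"
  assumes [measurable]: "G \<in> borel_measurable M" "y \<in> borel_measurable M"
  shows "(\<lambda>x. G x *v y x) \<in> borel_measurable M"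
  unfolding matrix_vector_mult_def by measurable

section \<open>Oblique residuals\<close>

text \<open>The vector \<open>p_i\<close> of the overview.\<close>

definition height :: "'a::hermitian_field^'n^'l \<Rightarrow> ('i \<Rightarrow> 'a^'n) \<Rightarrow> 'i list \<Rightarrow> 'i \<Rightarrow> 'a^'l" where
  "height G v js i = resid (\<lambda>j. G *v v j) (remove1 i js) (G *v v i)"

text \<open>The vector \<open>h_i\<close> of the overview; it is 0 if the height vanishes, since
  \<open>inverse 0 = 0\<close>.\<close>

definition dual :: "'a::hermitian_field^'n^'l \<Rightarrow> ('i \<Rightarrow> 'a^'n) \<Rightarrow> 'i list \<Rightarrow> 'i \<Rightarrow> 'a^'l" where
  "dual G v js i = inverse ((norm (height G v js i))\<^sup>2) *\<^sub>R height G v js i"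

definition oblique_resid ::
    "'a::hermitian_field^'n^'l \<Rightarrow> ('i \<Rightarrow> 'a^'n) \<Rightarrow> 'i list \<Rightarrow> 'a^'n \<Rightarrow> 'a^'n" where
  "oblique_resid G v js a = a - (\<Sum>i\<in>set js. cip (G *v a) (dual G v js i) *s v i)"

definition orth_resid :: "('i \<Rightarrow> 'a::hermitian_field^'n) \<Rightarrow> 'i list \<Rightarrow> 'a^'n \<Rightarrow> 'a^'n" where
  "orth_resid v js a = a - (\<Sum>i\<in>set js. cip a (v i) *s v i)"

definition orthonormal :: "('i \<Rightarrow> 'a::hermitian_field^'n) \<Rightarrow> 'i list \<Rightarrow> bool" where
  "orthonormal v js \<longleftrightarrow> distinct js \<and>
     (\<forall>i\<in>set js. \<forall>j\<in>set js. cip (v i) (v j) = (if i = j then 1 else 0))"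

lemma orthonormal_cip:
  "orthonormal v js \<Longrightarrow> i \<in> set js \<Longrightarrow> j \<in> set js \<Longrightarrow> cip (v i) (v j) = (if i = j then 1 else 0)"
  by (simp add: orthonormal_def)

lemma orthonormal_norm:
  fixes v :: "'i \<Rightarrow> 'a::hermitian_field^'n"
  assumes "orthonormal v js" "i \<in> set js"
  shows "norm (v i) = 1"
proof -
  have "of_real ((norm (v i))\<^sup>2) = (of_real 1 :: 'a)"
    using orthonormal_cip[OF assms(1) assms(2) assms(2)] by (simp only: cip_self of_real_1 simp_thms if_True)
  then show ?thesis by (simp only: of_real_eq_iff power2_eq_1_iff) (use norm_ge_zero[of "v i"] in linarith)
qed

lemma height_measurable [measurable (raw)]:
  assumes [measurable]: "G \<in> borel_measurable M" "\<And>j. (\<lambda>x. v x j) \<in> borel_measurable M"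
  shows "(\<lambda>x. height (G x) (v x) js i) \<in> borel_measurable M"
  unfolding height_def by measurable

lemma dual_measurable [measurable (raw)]:
  assumes [measurable]: "G \<in> borel_measurable M" "\<And>j. (\<lambda>x. v x j) \<in> borel_measurable M"
  shows "(\<lambda>x. dual (G x) (v x) js i) \<in> borel_measurable M"
  unfolding dual_def by measurable

lemma oblique_resid_measurable [measurable (raw)]:
  assumes [measurable]: "G \<in> borel_measurable M" "\<And>j. (\<lambda>x. v x j) \<in> borel_measurable M" "a \<in> borel_measurable M"
  shows "(\<lambda>x. oblique_resid (G x) (v x) js (a x)) \<in> borel_measurable M"
  unfolding oblique_resid_def by measurable

lemma orth_resid_measurable [measurable (raw)]:
  assumes [measurable]: "\<And>j. (\<lambda>x. v x j) \<in> borel_measurable M" "a \<in> borel_measurable M"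
  shows "(\<lambda>x. orth_resid (v x) js (a x)) \<in> borel_measurable M"
  unfolding orth_resid_def by measurable

text \<open>Resampling along \<open>v i\<close> makes \<open>G *v v i\<close> a fresh Gaussian and,
  by orthonormality, keeps all other \<open>G *v v j\<close>; the height becomes a residual of a
  fresh vector against fixed ones.\<close>

lemma nn_integral_inverse_height:
  fixes v :: "'i \<Rightarrow> 'a::hermitian_field^'n"
  assumes on: "orthonormal v js" and i: "i \<in> set js"
    and dims: "2 < real DIM('a) * (real CARD('l) - real (length js) + 1)"
  shows "(\<integral>\<^sup>+G. inverse (ennreal ((norm (height G v js i))\<^sup>2)) \<partial>(gauss :: ('a^'n^'l) measure)) \<le>
    ennreal (1 / (real DIM('a) * (real CARD('l) - real (length js) + 1) - 2))"
proof -
  let ?L = "\<lambda>y. (\<chi> k j. y $ k * conjugate (v i $ j)) :: 'a^'n^'l"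
  interpret coisometry ?L "\<lambda>G. G *v v i"
    using orthonormal_norm[OF on i] by (rule coisometry_outer)
  let ?js = "remove1 i js"
  \<comment> \<open>\<open>remove1\<close> drops exactly one entry, which is the origin of
    \<open>+ 1\<close> in the dimension count.\<close>
  have len: "real (length ?js) = real (length js) - 1"
    using i length_pos_if_in_set[OF i] by (simp add: length_remove1 of_nat_diff Suc_le_eq)
  have heights: "height (G - ?L (G *v v i) + ?L y) v js i = resid (\<lambda>j. G *v v j) ?js y" for G y
  proof -
    have fresh: "(G - ?L (G *v v i) + ?L y) *v v i = y"
      by (simp add: matrix_vector_mult_add_rdistrib matrix_vector_mult_diff_rdistrib left_inverse)
    have kept: "(G - ?L (G *v v i) + ?L y) *v v j = G *v v j" if "j \<in> set ?js" for j
    proof -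
      have "j \<in> set js" "j \<noteq> i" using that on by (auto simp: orthonormal_def)
      then show ?thesis
        using orthonormal_cip[OF on, of j i] i
        by (simp add: matrix_vector_mult_add_rdistrib matrix_vector_mult_diff_rdistrib outer_mult_vec)
    qed
    show ?thesis
      unfolding height_def fresh by (rule resid_cong) (rule kept)
  qed
  have "(\<integral>\<^sup>+G. inverse (ennreal ((norm (height G v js i))\<^sup>2)) \<partial>(gauss :: ('a^'n^'l) measure)) =
      (\<integral>\<^sup>+G. \<integral>\<^sup>+y. inverse (ennreal ((norm (resid (\<lambda>j. G *v v j) ?js y))\<^sup>2)) \<partial>gauss
        \<partial>(gauss :: ('a^'n^'l) measure))"
    by (subst nn_integral_resample) (simp_all only: heights, measurable)
  also have "\<dots> \<le> (\<integral>\<^sup>+G. ennreal (1 / (real DIM('a) * (real CARD('l) - real (length ?js)) - 2))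
      \<partial>(gauss :: ('a^'n^'l) measure))"
    using dims by (intro nn_integral_mono nn_integral_inverse_resid) (simp add: len algebra_simps)
  finally show ?thesis by (simp add: gauss.emeasure_space_1[simplified] len algebra_simps)
qed

text \<open>A finite inverse moment excludes the value 0 almost everywhere, because
  \<open>inverse 0\<close> is infinite in \<open>ennreal\<close>.\<close>

lemma AE_height_nonzero:
  fixes v :: "'i \<Rightarrow> 'a::hermitian_field^'n"
  assumes on: "orthonormal v js"
    and dims: "2 < real DIM('a) * (real CARD('l) - real (length js) + 1)"
  shows "AE G in (gauss :: ('a^'n^'l) measure). \<forall>i\<in>set js. height G v js i \<noteq> 0"
proof (rule AE_finite_allI)
  fix i assume "i \<in> set js"
  from nn_integral_inverse_height[OF on this dims]
  have "(\<integral>\<^sup>+G. inverse (ennreal ((norm (height G v js i))\<^sup>2)) \<partial>(gauss :: ('a^'n^'l) measure)) \<noteq> \<infinity>"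
    by (auto simp: top_unique)
  then have "AE G in (gauss :: ('a^'n^'l) measure). inverse (ennreal ((norm (height G v js i))\<^sup>2)) \<noteq> \<infinity>"
    by (intro nn_integral_PInf_AE) measurable
  then show "AE G in (gauss :: ('a^'n^'l) measure). height G v js i \<noteq> 0"
    by eventually_elim auto
qed simp

text \<open>Resampling along \<open>e\<close> leaves the dual vector alone, as it depends only on
  the \<open>G *v v j\<close>. Averaging over the fresh \<open>G *v e\<close> first leaves the
  squared norm of the dual vector, that is, an inverse squared height.\<close>

lemma nn_integral_cip_dual:
  fixes v :: "'i \<Rightarrow> 'a::hermitian_field^'n"
  assumes on: "orthonormal v js" and i: "i \<in> set js"
    and dims: "2 < real DIM('a) * (real CARD('l) - real (length js) + 1)"
    and e: "\<And>j. j \<in> set js \<Longrightarrow> cip e (v j) = 0"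
  shows "(\<integral>\<^sup>+G. ennreal ((norm (cip (G *v e) (dual G v js i)))\<^sup>2) \<partial>(gauss :: ('a^'n^'l) measure)) \<le>
    ennreal ((norm e)\<^sup>2 * (real DIM('a) / (real DIM('a) * (real CARD('l) - real (length js) + 1) - 2)))"
proof (cases "e = 0")
  case False
  define u where "u = of_real (1 / norm e) *s e"
  have u: "norm u = 1" using False by (simp add: u_def norm_scale_vec norm_divide)
  have e_u: "e = of_real (norm e) *s u" using False by (simp add: u_def)
  have uv: "cip (v j) u = 0" if "j \<in> set js" for j
    using e[OF that] by (simp add: u_def cip_scale_right cip_commute_zero)
  let ?L = "\<lambda>y. (\<chi> k j. y $ k * conjugate (u $ j)) :: 'a^'n^'l"
  interpret coisometry ?L "\<lambda>G. G *v u" using u by (rule coisometry_outer)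
  let ?d = "real DIM('a)" and ?D = "real DIM('a) * (real CARD('l) - real (length js) + 1) - 2"
  have Gv: "(G - ?L (G *v u) + ?L y) *v v j = G *v v j" if "j \<in> set js" for j G y
    using that by (simp add: matrix_vector_mult_add_rdistrib matrix_vector_mult_diff_rdistrib outer_mult_vec uv)
  have dual: "dual (G - ?L (G *v u) + ?L y) v js i = dual G v js i" for G y
  proof -
    have "height (G - ?L (G *v u) + ?L y) v js i = height G v js i"
      unfolding height_def Gv[OF i] using set_remove1_subset[of i js] by (intro resid_cong Gv) auto
    then show ?thesis by (simp add: dual_def)
  qed
  have Ge: "(G - ?L (G *v u) + ?L y) *v e = of_real (norm e) *s y" for G y
    by (subst e_u) (simp add: vector_scalar_commute matrix_vector_mult_add_rdistrib
        matrix_vector_mult_diff_rdistrib left_inverse)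
  \<comment> \<open>At a vanishing height the left side is 0 and the right side infinite, so only an
    inequality holds everywhere.\<close>
  have dual_le: "ennreal ((norm (dual G v js i))\<^sup>2) \<le> inverse (ennreal ((norm (height G v js i))\<^sup>2))" for G
  proof (cases "height G v js i = 0")
    case False
    then have "(norm (dual G v js i))\<^sup>2 = inverse ((norm (height G v js i))\<^sup>2)"
      by (simp add: dual_def power2_eq_square)
    with False show ?thesis by (simp add: inverse_ennreal)
  qed simp
  have "(\<integral>\<^sup>+G. ennreal ((norm (cip (G *v e) (dual G v js i)))\<^sup>2) \<partial>(gauss :: ('a^'n^'l) measure)) =
      (\<integral>\<^sup>+G. \<integral>\<^sup>+y. ennreal ((norm e)\<^sup>2) * ennreal ((norm (cip y (dual G v js i)))\<^sup>2) \<partial>gauss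
        \<partial>(gauss :: ('a^'n^'l) measure))"
    by (subst nn_integral_resample)
       (simp_all add: Ge dual cip_scale_left norm_mult power_mult_distrib ennreal_mult')
  also have "\<dots> = (\<integral>\<^sup>+G. ennreal ((norm e)\<^sup>2 * ?d) * ennreal ((norm (dual G v js i))\<^sup>2) \<partial>(gauss :: ('a^'n^'l) measure))"
    by (simp add: nn_integral_cmult nn_integral_gauss_cip ennreal_mult' mult.assoc)
  also have "\<dots> = ennreal ((norm e)\<^sup>2 * ?d) * (\<integral>\<^sup>+G. ennreal ((norm (dual G v js i))\<^sup>2) \<partial>(gauss :: ('a^'n^'l) measure))"
    by (simp add: nn_integral_cmult)
  also have "\<dots> \<le> ennreal ((norm e)\<^sup>2 * ?d) * ennreal (1 / ?D)"
    by (intro mult_left_mono order_trans[OF nn_integral_mono nn_integral_inverse_height[OF on i dims]] dual_le) simp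
  also have "\<dots> = ennreal ((norm e)\<^sup>2 * (?d / ?D))"
    using dims by (simp add: ennreal_mult'[symmetric])
  finally show ?thesis .
qed simp

lemma cip_orth_resid:
  assumes "orthonormal v js" "j \<in> set js"
  shows "cip (orth_resid v js a) (v j) = 0"
proof -
  have "(\<Sum>i\<in>set js. cip a (v i) * cip (v i) (v j)) = (\<Sum>i\<in>set js. if i = j then cip a (v i) else 0)"
    using assms by (intro sum.cong) (auto simp: orthonormal_cip)
  then show ?thesis
    using assms by (simp add: orth_resid_def cip_diff_left cip_sum_left cip_scale_left)
qed

lemma norm_sum_orthonormal:
  fixes v :: "'i \<Rightarrow> 'a::hermitian_field^'n"
  assumes "orthonormal v js"
  shows "(norm (\<Sum>i\<in>set js. c i *s v i))\<^sup>2 = (\<Sum>i\<in>set js. (norm (c i))\<^sup>2)"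
proof -
  have "cip (\<Sum>i\<in>set js. c i *s v i) (\<Sum>i\<in>set js. c i *s v i) =
      (\<Sum>i\<in>set js. \<Sum>j\<in>set js. if i = j then c i * conjugate (c i) else 0)"
    using assms unfolding cip_sum_left unfolding cip_sum_right
    by (intro sum.cong) (auto simp: cip_scale_left cip_scale_right orthonormal_cip)
  then have "of_real ((norm (\<Sum>i\<in>set js. c i *s v i))\<^sup>2) = (of_real (\<Sum>i\<in>set js. (norm (c i))\<^sup>2) :: 'a)"
    by (simp add: cip_self mult_conjugate_self)
  then show ?thesis by (simp only: of_real_eq_iff)
qed

text \<open>The height is the orthogonal projection of \<open>G *v v i\<close>, so their product is
  its squared norm; it is orthogonal to the other images.\<close>

lemma cip_dual_generator:
  assumes "distinct js" "i \<in> set js" "j \<in> set js" "height G v js i \<noteq> 0"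
  shows "cip (G *v v j) (dual G v js i) = (if i = j then 1 else 0)"
proof (cases "i = j")
  case True
  let ?h = "height G v js i"
  have "cip (G *v v i) ?h = of_real ((norm ?h)\<^sup>2)"
    unfolding height_def by (rule cip_resid_self)
  then show ?thesis
    using True assms(4) by (simp add: dual_def cip_scaleR_right) (simp add: scaleR_conv_of_real)
next
  case False
  then have "cip (height G v js i) (G *v v j) = 0"
    using assms(3) unfolding height_def by (intro cip_resid_generator[where g="\<lambda>j. G *v v j"]) auto
  then show ?thesis
    using False by (simp add: dual_def cip_commute_zero[of "G *v v j"] cip_scaleR_left)
qed

text \<open>By biorthogonality the oblique coefficients of \<open>a\<close> are its orthogonal ones
  plus those of the residual \<open>?e\<close>. The excess lies in the span of the
  \<open>v i\<close>, orthogonal to \<open>?e\<close>.\<close>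

lemma norm_oblique_resid:
  assumes on: "orthonormal v js" and h: "\<forall>i\<in>set js. height G v js i \<noteq> 0"
  shows "(norm (oblique_resid G v js a))\<^sup>2 = (norm (orth_resid v js a))\<^sup>2 +
    (\<Sum>i\<in>set js. (norm (cip (G *v orth_resid v js a) (dual G v js i)))\<^sup>2)"
proof -
  let ?e = "orth_resid v js a"
  have dist: "distinct js" using on by (simp add: orthonormal_def)
  have coeff: "cip (G *v a) (dual G v js i) = cip a (v i) + cip (G *v ?e) (dual G v js i)"
    if i: "i \<in> set js" for i
  proof -
    have "G *v a = G *v ?e + (\<Sum>j\<in>set js. cip a (v j) *s (G *v v j))"
      by (simp add: orth_resid_def vec.diff vec.sum vec.scale)
    then have "cip (G *v a) (dual G v js i) = cip (G *v ?e) (dual G v js i) +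
        (\<Sum>j\<in>set js. cip a (v j) * (if i = j then 1 else 0))"
      using dist h i by (simp add: cip_add_left cip_sum_left cip_scale_left cip_dual_generator)
    then show ?thesis using i by (simp add: if_distrib cong: if_cong)
  qed
  have "oblique_resid G v js a = ?e - (\<Sum>i\<in>set js. cip (G *v ?e) (dual G v js i) *s v i)"
    by (simp add: oblique_resid_def orth_resid_def coeff[unfolded orth_resid_def] vec.scale_left_distrib sum.distrib)
  moreover have "cip ?e (\<Sum>i\<in>set js. cip (G *v ?e) (dual G v js i) *s v i) = 0"
    using on by (simp add: cip_sum_right cip_scale_right cip_orth_resid)
  ultimately show ?thesis
    using on by (simp add: norm_diff_square_orthogonal norm_sum_orthonormal)
qed

lemma nn_integral_oblique_resid:
  fixes v :: "'i \<Rightarrow> 'a::hermitian_field^'n"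
  assumes on: "orthonormal v js"
    and dims: "2 < real DIM('a) * (real CARD('l) - real (length js) + 1)"
  shows "(\<integral>\<^sup>+G. ennreal ((norm (oblique_resid G v js a))\<^sup>2) \<partial>(gauss :: ('a^'n^'l) measure)) \<le>
    ennreal ((1 + real (length js) / (real CARD('l) - real (length js) - (2 / real DIM('a) - 1))) *
      (norm (orth_resid v js a))\<^sup>2)"
proof -
  let ?e = "orth_resid v js a"
  let ?c = "real DIM('a) / (real DIM('a) * (real CARD('l) - real (length js) + 1) - 2)"
  \<comment> \<open>Dividing numerator and denominator by the real dimension produces the parameter
    \<open>2 / DIM('a) - 1\<close>.\<close>
  have c: "?c = 1 / (real CARD('l) - real (length js) - (2 / real DIM('a) - 1))"
    using dims by (simp add: divide_simps) (simp add: algebra_simps)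
  have c0: "0 \<le> ?c" using dims by simp
  have "(\<integral>\<^sup>+G. ennreal ((norm (oblique_resid G v js a))\<^sup>2) \<partial>(gauss :: ('a^'n^'l) measure)) =
      (\<integral>\<^sup>+G. ennreal ((norm ?e)\<^sup>2) + (\<Sum>i\<in>set js. ennreal ((norm (cip (G *v ?e) (dual G v js i)))\<^sup>2))
        \<partial>(gauss :: ('a^'n^'l) measure))"
  proof (rule nn_integral_cong_AE)
    show "AE G in (gauss :: ('a^'n^'l) measure). ennreal ((norm (oblique_resid G v js a))\<^sup>2) =
      ennreal ((norm ?e)\<^sup>2) + (\<Sum>i\<in>set js. ennreal ((norm (cip (G *v ?e) (dual G v js i)))\<^sup>2))"
      using AE_height_nonzero[OF on dims]
      by eventually_elim (simp add: norm_oblique_resid[OF on] sum_nonneg)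
  qed
  also have "\<dots> = ennreal ((norm ?e)\<^sup>2) + (\<Sum>i\<in>set js. \<integral>\<^sup>+G. ennreal ((norm (cip (G *v ?e) (dual G v js i)))\<^sup>2)
        \<partial>(gauss :: ('a^'n^'l) measure))"
    by (subst nn_integral_add)
       (simp_all add: nn_integral_sum gauss.emeasure_space_1[simplified] del: sum_ennreal)
  also have "\<dots> \<le> ennreal ((norm ?e)\<^sup>2) + (\<Sum>i\<in>set js. ennreal ((norm ?e)\<^sup>2 * ?c))"
    by (intro add_left_mono sum_mono nn_integral_cip_dual on dims cip_orth_resid) auto
  also have "\<dots> = ennreal ((1 + real (length js) * ?c) * (norm ?e)\<^sup>2)"
  proof -
    have "ennreal E + (\<Sum>i\<in>set js. ennreal (E * C)) = ennreal ((1 + real (length js) * C) * E)"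
      if "0 \<le> E" "0 \<le> C" for E C
      using on that distinct_card[of js]
      by (simp add: orthonormal_def ennreal_of_nat_eq_real_of_nat ennreal_mult[symmetric]
          ennreal_plus[symmetric] algebra_simps del: ennreal_plus)
    from this[OF _ c0] show ?thesis by simp
  qed
  finally show ?thesis by (simp add: c)
qed

section \<open>Matrices and pseudoinverses\<close>

lemma orth_resid_diff: "orth_resid v js (x - y) = orth_resid v js x - orth_resid v js y"
  by (simp add: orth_resid_def cip_diff_left vec.scale_left_diff_distrib sum_subtractf)

text \<open>Any two approximations from the span differ by a vector of the span, which is orthogonal
  to the residual; Pythagoras gives minimality.\<close>

lemma norm_orth_resid_le_diff:
  assumes "orthonormal v js"
  shows "norm (orth_resid v js a) \<le> norm (a - (\<Sum>i\<in>set js. c i *s v i))"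
proof -
  let ?d = "\<Sum>i\<in>set js. (cip a (v i) - c i) *s v i"
  have "cip (orth_resid v js a) ?d = 0"
    unfolding cip_sum_right cip_scale_right using assms by (simp add: cip_orth_resid)
  moreover have "a - (\<Sum>i\<in>set js. c i *s v i) = orth_resid v js a + ?d"
    by (simp add: orth_resid_def vec.scale_left_diff_distrib sum_subtractf)
  ultimately have "(norm (orth_resid v js a))\<^sup>2 \<le> (norm (a - (\<Sum>i\<in>set js. c i *s v i)))\<^sup>2"
    by (simp add: norm_add_square_orthogonal)
  then show ?thesis by (rule power2_le_imp_le) simp
qed

lemma norm_orth_resid_le: "orthonormal v js \<Longrightarrow> norm (orth_resid v js a) \<le> norm a"
  using norm_orth_resid_le_diff[of v js a "\<lambda>_. 0"] by simp

text \<open>Gram--Schmidt that skips dependent vectors. The list indexes itself through the identity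
  family, and a zero residual encodes membership in the span.\<close>

lemma orthonormal_spanning_list:
  fixes us :: "('a::hermitian_field^'n) list"
  shows "\<exists>vs. orthonormal (\<lambda>x. x) vs \<and> length vs \<le> length us \<and> (\<forall>u\<in>set us. orth_resid (\<lambda>x. x) vs u = 0)"
proof (induction us)
  case Nil
  show ?case by (intro exI[of _ "[]"]) (simp add: orthonormal_def)
next
  case (Cons u us)
  then obtain vs where on: "orthonormal (\<lambda>x. x) vs" and len: "length vs \<le> length us"
    and span: "\<And>x. x \<in> set us \<Longrightarrow> orth_resid (\<lambda>x. x) vs x = 0" by blast
  define w where "w = orth_resid (\<lambda>x. x) vs u"
  show ?case
  proof (cases "w = 0")
    case True
    then show ?thesis using on len span by (intro exI[of _ vs]) (auto simp: w_def)
  next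
    case False
    define b where "b = of_real (1 / norm w) *s w"
    have b: "cip b b = 1" using False by (simp add: b_def cip_self norm_scale_vec norm_divide)
    have b_orth: "cip b x = 0" "cip x b = 0" if "x \<in> set vs" for x
      using cip_orth_resid[OF on that, of u]
      by (simp_all add: b_def w_def cip_scale_left cip_scale_right cip_commute_zero[of x])
    have "b \<notin> set vs" using b b_orth by force
    then have on': "orthonormal (\<lambda>x. x) (b # vs)"
      using on b b_orth by (auto simp: orthonormal_def)
    have step: "orth_resid (\<lambda>x. x) (b # vs) a = orth_resid (\<lambda>x. x) vs a - cip a b *s b" for a
      using \<open>b \<notin> set vs\<close> by (simp add: orth_resid_def)
    have cip_b: "cip a b = cip (orth_resid (\<lambda>x. x) vs a) b" for a
      by (simp add: orth_resid_def cip_diff_left cip_sum_left cip_scale_left b_orth)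
    have "cip w b *s b = w"
      using False by (simp add: b_def cip_scale_right conjugate_scaleR of_real_def cip_self power2_eq_square)
    then have "orth_resid (\<lambda>x. x) (b # vs) u = 0"
      using step[of u] cip_b[of u] by (simp add: w_def)
    moreover have "orth_resid (\<lambda>x. x) (b # vs) x = 0" if "x \<in> set us" for x
      using step[of x] cip_b[of x] span[OF that] by simp
    ultimately show ?thesis using on' len by (intro exI[of _ "b # vs"]) auto
  qed
qed

section \<open>Conjugate transpose and columns\<close>

lemma ctrans_ctrans [simp]: "ctrans (ctrans A) = A"
  by (simp add: ctrans_def vec_eq_iff)

lemma ctrans_add: "ctrans (A + B :: 'a::hermitian_field^'n^'m) = ctrans A + ctrans B"
  and ctrans_diff: "ctrans (A - B :: 'a::hermitian_field^'n^'m) = ctrans A - ctrans B"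
  and ctrans_scaleR: "ctrans (r *\<^sub>R A :: 'a::hermitian_field^'n^'m) = r *\<^sub>R ctrans A"
  by (simp_all add: ctrans_def vec_eq_iff conjugate_dist_add conjugate_diff conjugate_scaleR)

lemma ctrans_mat_1 [simp]: "ctrans (mat 1 :: 'a::hermitian_field^'n^'n) = mat 1"
  by (simp add: ctrans_def mat_def vec_eq_iff)

lemma ctrans_mult: "ctrans (A ** B) = ctrans B ** ctrans (A :: 'a::hermitian_field^'n^'m)"
  by (simp add: ctrans_def matrix_matrix_mult_def vec_eq_iff sum_conjugate conjugate_dist_mul mult.commute)

lemma norm_ctrans [simp]: "norm (ctrans A) = norm (A :: 'a::hermitian_field^'n^'m)"
proof -
  have "(norm (ctrans A))\<^sup>2 = (norm A)\<^sup>2"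
    unfolding norm_matrix_eq_frobenius by (subst sum.swap) (simp add: ctrans_def)
  then show ?thesis by simp
qed

text \<open>Consequently the conjugate transpose of a standard Gaussian matrix is again one, so
  \<open>ctrans \<Omega>\<close> can play the role of \<open>G\<close>.\<close>

lemma coisometry_ctrans:
  "coisometry (ctrans :: 'a::hermitian_field^'n^'m \<Rightarrow> 'a^'m^'n) ctrans"
proof (rule coisometry.intro)
  show "linear (ctrans :: 'a^'n^'m \<Rightarrow> 'a^'m^'n)" "linear (ctrans :: 'a^'m^'n \<Rightarrow> 'a^'n^'m)"
    by (intro linearI ctrans_add ctrans_scaleR)+
  have "a \<bullet> conjugate b = conjugate a \<bullet> b" for a b :: 'a
    using inner_conjugate_conjugate[of a "conjugate b"] by simp
  then show "x \<bullet> ctrans y = ctrans x \<bullet> y" for x :: "'a^'m^'n" and y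
    unfolding inner_vec_def ctrans_def by (subst sum.swap) simp
qed simp

lemma cip_matrix_vector: "cip (A *v x) y = cip x (ctrans A *v y)"
  unfolding cip_def matrix_vector_mult_def ctrans_def
  by (simp add: sum_distrib_left sum_distrib_right sum_conjugate conjugate_dist_mul mult_ac)
     (rule sum.swap)

lemma norm_square_columns:
  fixes A :: "'a::hermitian_field^'n^'m"
  shows "(norm A)\<^sup>2 = (\<Sum>c\<in>UNIV. (norm (column c A))\<^sup>2)"
  unfolding norm_matrix_eq_frobenius
  by (subst sum.swap) (simp add: norm_vec_def L2_set_def sum_nonneg column_def)

lemma column_mult: "column c (A ** B) = A *v column c B"
  by (simp add: column_def matrix_matrix_mult_def matrix_vector_mult_def vec_eq_iff)

lemma column_diff: "column c (A - B :: 'a::ab_group_add^'n^'m) = column c A - column c B"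
  by (simp add: column_def vec_eq_iff)

lemma orthonormal_columns:
  fixes Q :: "'a::hermitian_field^'k^'n"
  assumes "ctrans Q ** Q = mat 1" "distinct ks"
  shows "orthonormal (\<lambda>k. column k Q) ks"
proof -
  have "cip (column i Q) (column j Q) = (ctrans Q ** Q) $ j $ i" for i j
    by (simp add: cip_def column_def ctrans_def matrix_matrix_mult_def mult.commute)
  then show ?thesis using assms by (simp add: orthonormal_def mat_def)
qed

lemma norm_orth_resid_range_le:
  fixes A :: "'a::hermitian_field^'n^'n" and \<Omega> Q :: "'a^'k^'n"
  assumes A: "ctrans A = A" and Q: "ctrans Q ** Q = mat 1" and QR: "A ** \<Omega> = Q ** R"
    and ks: "set ks = UNIV" "distinct ks"
  shows "(\<Sum>c\<in>UNIV. (norm (orth_resid (\<lambda>k. column k Q) ks (column c A)))\<^sup>2) \<le>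
    (\<Sum>c\<in>UNIV. (norm (oblique_resid (ctrans \<Omega>) v js (column c A)))\<^sup>2)"
proof -
  \<comment> \<open>\<open>Z\<close> maps sketch values to the oblique approximation, so the columns
    of \<open>D\<close> below are oblique residuals.\<close>
  define Z :: "'a^'k^'n" where
    "Z = (\<chi> j m. \<Sum>i\<in>set js. v i $ j * conjugate (dual (ctrans \<Omega>) v js i $ m))"
  have Z: "Z *v y = (\<Sum>i\<in>set js. cip y (dual (ctrans \<Omega>) v js i) *s v i)" for y
    by (simp add: vec_eq_iff Z_def matrix_vector_mult_def cip_def sum_distrib_left sum_distrib_right)
       (subst sum.swap, simp add: mult_ac)
  define D where "D = A - Z ** (ctrans \<Omega> ** A)"
  have col_D: "column c D = oblique_resid (ctrans \<Omega>) v js (column c A)" for c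
    by (simp add: D_def column_diff column_mult Z oblique_resid_def)
  \<comment> \<open>Taking the conjugate transpose moves \<open>A ** \<Omega>\<close> to the left;
    thus the approximation error \<open>ctrans D\<close> competes with the best approximation in the
    range of \<open>Q\<close>.\<close>
  have D: "ctrans D = A - Q ** (R ** ctrans Z)"
    by (simp add: D_def ctrans_diff ctrans_mult A QR[symmetric] matrix_mul_assoc)
  have "(\<Sum>c\<in>UNIV. (norm (orth_resid (\<lambda>k. column k Q) ks (column c A)))\<^sup>2) \<le>
      (\<Sum>c\<in>UNIV. (norm (column c (ctrans D)))\<^sup>2)"
  proof (intro sum_mono power_mono)
    fix c
    let ?x = "column c (R ** ctrans Z)"
    have "column c (ctrans D) = column c A - (\<Sum>k\<in>set ks. ?x $ k *s column k Q)"
      by (simp add: D column_diff column_mult[of c Q] matrix_mult_sum ks)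
    then show "norm (orth_resid (\<lambda>k. column k Q) ks (column c A)) \<le> norm (column c (ctrans D))"
      using norm_orth_resid_le_diff[OF orthonormal_columns[OF Q ks(2)], of "column c A" "\<lambda>k. ?x $ k"]
      by simp
  qed simp
  also have "\<dots> = (norm D)\<^sup>2" by (simp add: norm_square_columns[symmetric])
  finally show ?thesis by (simp add: norm_square_columns col_D)
qed

section \<open>The Moore--Penrose pseudoinverse as a dual basis\<close>

lemma is_pinv_unique:
  fixes A :: "'a::hermitian_field^'n^'m"
  assumes X: "is_pinv A X" and Y: "is_pinv A Y"
  shows "X = Y"
proof -
  \<comment> \<open>\<open>A ** X\<close> and \<open>A ** Y\<close> are Hermitian projections with
    the same range, hence equal; the products in the other order are treated likewise.\<close>
  have "A ** X = ctrans (A ** X)" using X by (simp add: is_pinv_def)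
  also have "\<dots> = ctrans ((A ** Y) ** (A ** X))"
    using Y by (simp add: is_pinv_def matrix_mul_assoc)
  also have "\<dots> = (A ** X) ** (A ** Y)" using X Y by (simp add: is_pinv_def ctrans_mult)
  also have "\<dots> = A ** Y" using X by (simp add: is_pinv_def matrix_mul_assoc)
  finally have AX: "A ** X = A ** Y" .
  have "X ** A = ctrans (X ** A)" using X by (simp add: is_pinv_def)
  also have "\<dots> = ctrans ((X ** A) ** (Y ** A))"
    using Y by (simp add: is_pinv_def matrix_mul_assoc[symmetric])
  also have "\<dots> = (Y ** A) ** (X ** A)" using X Y by (simp add: is_pinv_def ctrans_mult)
  also have "\<dots> = Y ** A" using X by (simp add: is_pinv_def matrix_mul_assoc[symmetric])
  finally have XA: "X ** A = Y ** A" .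
  have "X = X ** (A ** X)" using X by (simp add: is_pinv_def matrix_mul_assoc)
  also have "\<dots> = (X ** A) ** Y" by (simp add: AX matrix_mul_assoc)
  also have "\<dots> = Y" using Y by (simp add: XA is_pinv_def)
  finally show ?thesis .
qed

lemma is_pinv_normal_equation:
  fixes A :: "'a::hermitian_field^'n^'m"
  assumes "is_pinv A X"
  shows "ctrans A ** (A ** X) = ctrans A"
proof -
  have "ctrans (A ** X ** A) = ctrans A ** ctrans (A ** X)" by (rule ctrans_mult)
  then show ?thesis using assms by (simp add: is_pinv_def)
qed

lemma is_pinv_pinv_if_injective:
  fixes G :: "'a::hermitian_field^'k^'l"
  assumes inj: "\<And>x. G *v x = 0 \<Longrightarrow> x = 0"
  shows "is_pinv G (pinv G)"
proof -
  define H where "H = ctrans G ** G"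
  have "x = 0" if "H *v x = 0" for x
  proof -
    \<comment> \<open>The Gram matrix \<open>H\<close> inherits injectivity from \<open>G\<close>,
      hence is invertible.\<close>
    have "cip (G *v x) (G *v x) = cip x (H *v x)"
      by (simp add: cip_matrix_vector H_def matrix_vector_mul_assoc)
    then show ?thesis using that inj by simp
  qed
  then obtain B where B: "B ** H = mat 1"
    using matrix_left_invertible_ker[of H] by blast
  then have B': "H ** B = mat 1" by (simp add: matrix_left_right_inverse)
  have H: "ctrans H = H" by (simp add: H_def ctrans_mult)
  have "ctrans B ** H = mat 1" using arg_cong[OF B', of ctrans] by (simp add: ctrans_mult H)
  then have "ctrans B ** (H ** B) = B" by (simp add: matrix_mul_assoc)
  then have cB: "ctrans B = B" by (simp add: B')
  \<comment> \<open>With full column rank the pseudoinverse is the inverse Gram matrix times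
    \<open>ctrans G\<close>.\<close>
  define X where "X = B ** ctrans G"
  have XG: "X ** G = mat 1" using B by (simp add: X_def H_def matrix_mul_assoc)
  have "is_pinv G X"
    unfolding is_pinv_def
  proof (intro conjI)
    show "G ** X ** G = G" by (simp add: matrix_mul_assoc[symmetric] XG)
    show "ctrans (G ** X) = G ** X" by (simp add: X_def ctrans_mult cB matrix_mul_assoc)
  qed (simp_all add: XG)
  then show ?thesis
    unfolding pinv_def by (rule theI[of "is_pinv G" X]) (rule is_pinv_unique[OF _ \<open>is_pinv G X\<close>])
qed

text \<open>The dual vectors read off coordinates in the range of \<open>\<Psi> ** Q\<close>;
  nonzero heights therefore give injectivity. Least-squares residuals are orthogonal to this range,
  hence to the dual vectors.\<close>

lemma pinv_coefficient:
  fixes \<Psi> :: "'a::hermitian_field^'n^'l" and Q :: "'a^'k^'n"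
  assumes h: "\<forall>i\<in>set ks. height \<Psi> (\<lambda>k. column k Q) ks i \<noteq> 0"
    and ks: "set ks = UNIV" "distinct ks"
  shows "(pinv (\<Psi> ** Q) *v y) $ i = cip y (dual \<Psi> (\<lambda>k. column k Q) ks i)"
proof -
  let ?G = "\<Psi> ** Q" and ?g = "\<lambda>k. \<Psi> *v column k Q"
  let ?d = "dual \<Psi> (\<lambda>k. column k Q) ks i"
  have coord: "cip (?G *v x) (dual \<Psi> (\<lambda>k. column k Q) ks i) = x $ i" for x i
  proof -
    have "?G *v x = (\<Sum>k\<in>UNIV. x $ k *s ?g k)"
      by (simp add: matrix_mult_sum column_mult)
    moreover have "cip (?g k) (dual \<Psi> (\<lambda>k. column k Q) ks i) = (if i = k then 1 else 0)" for k
      using cip_dual_generator[of ks i k \<Psi> "\<lambda>k. column k Q"] h ks by simp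
    ultimately have "cip (?G *v x) (dual \<Psi> (\<lambda>k. column k Q) ks i) =
        (\<Sum>k\<in>UNIV. x $ k * (if i = k then 1 else 0))"
      by (simp only: cip_sum_left cip_scale_left)
    then show ?thesis by (simp add: if_distrib cong: if_cong)
  qed
  have "x = 0" if "?G *v x = 0" for x
    using coord[of x] that by (simp add: vec_eq_iff)
  then have pinv: "is_pinv ?G (pinv ?G)" by (rule is_pinv_pinv_if_injective)
  define z where "z = y - ?G *v (pinv ?G *v y)"
  have "ctrans ?G *v z = 0"
    using is_pinv_normal_equation[OF pinv]
    by (simp add: z_def matrix_vector_mult_diff_distrib matrix_vector_mul_assoc)
  moreover have "(ctrans ?G *v z) $ k = cip z (column k ?G)" for k
    by (simp add: matrix_vector_mult_def ctrans_def cip_def column_def mult.commute)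
  ultimately have z: "cip z (?g k) = 0" for k by (simp add: column_mult)
  \<comment> \<open>The projection in the height can be moved onto \<open>z\<close>, which it fixes
    because \<open>z\<close> is orthogonal to every \<open>?g k\<close>.\<close>
  have "cip z (height \<Psi> (\<lambda>k. column k Q) ks i) = 0"
    by (simp add: height_def cip_resid_left[symmetric] resid_orthogonal z)
  then have "cip z ?d = 0" by (simp add: dual_def cip_scaleR_right)
  then have "cip y ?d = cip (?G *v (pinv ?G *v y)) ?d" by (simp add: z_def cip_diff_left)
  then show ?thesis by (simp add: coord)
qed

lemma column_error_A_hat:
  fixes \<Psi> :: "'a::hermitian_field^'n^'l" and \<Omega> :: "'a^'k^'n"
  assumes h: "\<forall>i\<in>set ks. height \<Psi> (\<lambda>k. column k (q (A ** \<Omega>))) ks i \<noteq> 0"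
    and ks: "set ks = UNIV" "distinct ks"
  shows "column c (A - A_hat q A \<Omega> \<Psi>) = oblique_resid \<Psi> (\<lambda>k. column k (q (A ** \<Omega>))) ks (column c A)"
  unfolding A_hat_def Let_def oblique_resid_def column_diff column_mult
  by (subst matrix_mult_sum) (simp add: pinv_coefficient[OF h ks] ks)

section \<open>Hermitian part and its rank\<close>

lemma norm_error_A_hat_sym_le:
  fixes A :: "'a::hermitian_field^'n^'n"
  assumes "ctrans A = A"
  shows "norm (A - A_hat_sym q A \<Omega> \<Psi>) \<le> norm (A - A_hat q A \<Omega> \<Psi>)"
proof -
  let ?E = "A - A_hat q A \<Omega> \<Psi>"
  \<comment> \<open>As \<open>A\<close> is Hermitian, the symmetrized error is the average of
    \<open>?E\<close> and \<open>ctrans ?E\<close>, which have equal norms.\<close>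
  have "A - A_hat_sym q A \<Omega> \<Psi> = (1/2) *\<^sub>R (?E + ctrans ?E)"
    using assms by (simp add: A_hat_sym_def ctrans_diff algebra_simps scaleR_2[symmetric])
  then have "norm (A - A_hat_sym q A \<Omega> \<Psi>) = norm (?E + ctrans ?E) / 2" by simp
  also have "\<dots> \<le> norm ?E" using norm_triangle_ineq[of ?E "ctrans ?E"] by simp
  finally show ?thesis .
qed

lemma ctrans_A_hat_sym:
  fixes A :: "'a::hermitian_field^'n^'n"
  shows "ctrans (A_hat_sym q A \<Omega> \<Psi>) = A_hat_sym q A \<Omega> \<Psi>"
  by (simp add: A_hat_sym_def ctrans_scaleR ctrans_add add.commute)

lemma row_mult: "row i (A ** B) = (\<Sum>k\<in>UNIV. A $ i $ k *s row k B)"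
  by (simp add: row_def matrix_matrix_mult_def vec_eq_iff)

lemma rank_A_hat_sym:
  fixes A :: "'a::hermitian_field^'n^'n" and \<Omega> :: "'a^'k^'n" and \<Psi> :: "'a^'n^'l"
  shows "rank (A_hat_sym q A \<Omega> \<Psi>) \<le> 2 * CARD('k)"
proof -
  define Q where "Q = q (A ** \<Omega>)"
  define X where "X = pinv (\<Psi> ** Q) ** (\<Psi> ** A)"
  \<comment> \<open>All rows are combinations of the rows of \<open>X\<close> and of
    \<open>ctrans Q\<close>, at most \<open>2 * CARD('k)\<close> vectors.\<close>
  define W where "W = range (\<lambda>k. row k X) \<union> range (\<lambda>k. row k (ctrans Q))"
  have "row i (A_hat_sym q A \<Omega> \<Psi>) = (of_real (1/2) :: 'a) *s (row i (Q ** X) + row i (ctrans X ** ctrans Q))" for i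
    by (simp add: A_hat_sym_def A_hat_def Let_def Q_def[symmetric] X_def[symmetric] ctrans_mult
        row_def vec_eq_iff) (simp add: scaleR_conv_of_real)
  moreover have "row i (Q ** X) \<in> vec.span W" "row i (ctrans X ** ctrans Q) \<in> vec.span W" for i
    unfolding row_mult
    by (rule vec.span_sum, rule vec.span_scale, rule vec.span_base, simp add: W_def)+
  ultimately have "rows (A_hat_sym q A \<Omega> \<Psi>) \<subseteq> vec.span W"
    by (auto simp: rows_def simp del: of_real_divide intro!: vec.span_scale vec.span_add)
  then have "rank (A_hat_sym q A \<Omega> \<Psi>) \<le> card W"
    unfolding row_rank_def_gen by (rule vec.dim_le_card) (simp add: W_def)
  also have "\<dots> \<le> card (range (\<lambda>k. row k X)) + card (range (\<lambda>k. row k (ctrans Q)))"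
    unfolding W_def by (rule card_Un_le)
  also have "\<dots> \<le> 2 * CARD('k)"
    using card_image_le[of UNIV "\<lambda>k. row k X"] card_image_le[of UNIV "\<lambda>k. row k (ctrans Q)"] by simp
  finally show ?thesis .
qed

section \<open>Error bounds\<close>

text \<open>Projecting off the conjugated row space of \<open>B\<close> annihilates
  \<open>ctrans B\<close> and contracts the rest; \<open>A\<close> is its own conjugate
  transpose.\<close>

lemma sum_norm_orth_resid_le_tail:
  fixes A B :: "'a::hermitian_field^'n^'n"
  assumes A: "ctrans A = A"
  shows "\<exists>vs. orthonormal (\<lambda>x. x) vs \<and> length vs \<le> rank B \<and>
    (\<Sum>c\<in>UNIV. (norm (orth_resid (\<lambda>x. x) vs (column c A)))\<^sup>2) \<le> (norm (A - B))\<^sup>2"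
proof -
  obtain T where T: "T \<subseteq> rows B" "vec.independent T" "rows B \<subseteq> vec.span T" "card T = vec.dim (rows B)"
    by (rule vec.basis_exists)
  have "rows B = range (\<lambda>i. row i B)" by (auto simp: rows_def)
  then have "finite T" using T(1) finite_subset by (metis finite_imageI finite)
  then obtain ts where ts: "set ts = T" "distinct ts" using finite_distinct_list by blast
  \<comment> \<open>Columns of \<open>ctrans B\<close> are conjugated rows of
    \<open>B\<close>.\<close>
  define conj_vec where "conj_vec x = (\<chi> j. conjugate (x $ j))" for x :: "'a^'n"
  obtain vs where on: "orthonormal (\<lambda>x. x) vs" and len: "length vs \<le> length (map conj_vec ts)"
    and span: "\<forall>u\<in>set (map conj_vec ts). orth_resid (\<lambda>x. x) vs u = 0"
    using orthonormal_spanning_list by blast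
  have length_vs: "length vs \<le> rank B"
    using len T(4) ts distinct_card[of ts] by (simp add: row_rank_def_gen)
  have "orth_resid (\<lambda>x. x) vs (conj_vec x) = 0" if "x \<in> vec.span T" for x
    using that
  proof (induction rule: vec.span_induct_alt)
    case base
    have "conj_vec 0 = 0" by (simp add: conj_vec_def vec_eq_iff)
    then show ?case by (simp add: orth_resid_def)
  next
    case (step c x y)
    have "conj_vec (c *s x + y) = conjugate c *s conj_vec x + conj_vec y"
      by (simp add: conj_vec_def vec_eq_iff conjugate_dist_add conjugate_dist_mul)
    moreover have "orth_resid (\<lambda>x. x) vs (d *s x + y) = d *s orth_resid (\<lambda>x. x) vs x + orth_resid (\<lambda>x. x) vs y" for d x y
      by (simp add: orth_resid_def cip_add_left cip_scale_left vec.scale_left_distrib sum.distrib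
          vec.scale_right_diff_distrib vec.scale_sum_right)
    ultimately show ?case using step span ts by simp
  qed
  then have zero: "orth_resid (\<lambda>x. x) vs (conj_vec (row c B)) = 0" for c
    using T(3) by (auto simp: rows_def)
  have "(\<Sum>c\<in>UNIV. (norm (orth_resid (\<lambda>x. x) vs (column c A)))\<^sup>2) \<le>
      (\<Sum>c\<in>UNIV. (norm (column c (ctrans (A - B))))\<^sup>2)"
  proof (intro sum_mono power_mono)
    fix c
    have "column c (ctrans (A - B)) = column c A - conj_vec (row c B)"
      by (simp add: ctrans_diff A column_diff) (simp add: column_def ctrans_def conj_vec_def row_def)
    then show "norm (orth_resid (\<lambda>x. x) vs (column c A)) \<le> norm (column c (ctrans (A - B)))"
      using norm_orth_resid_le[OF on, of "column c (ctrans (A - B))"] zero[of c] by (simp add: orth_resid_diff)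
  qed simp
  then show ?thesis using on length_vs by (auto simp: norm_square_columns[symmetric])
qed

lemma f_ratio_mono:
  assumes "r \<le> s" "s + \<alpha> < t"
  shows "f_ratio \<alpha> r t \<le> f_ratio \<alpha> s t"
  using assms unfolding f_ratio_def by (intro frac_le) auto

lemma f_ratio_nonneg: "s + \<alpha> < t \<Longrightarrow> 0 \<le> f_ratio \<alpha> s t"
  unfolding f_ratio_def by (intro divide_nonneg_nonneg) auto

lemma nn_integral_oblique_resid_sum:
  fixes v :: "'i \<Rightarrow> 'a::hermitian_field^'n" and a :: "'c::finite \<Rightarrow> 'a^'n"
  assumes \<alpha>: "real \<alpha> = 2 / real DIM('a) - 1"
    and on: "orthonormal v js" and dims: "length js + \<alpha> < CARD('l::finite)"
  shows "(\<integral>\<^sup>+G. ennreal (\<Sum>c\<in>UNIV. (norm (oblique_resid G v js (a c)))\<^sup>2) \<partial>(gauss :: ('a^'n^'l) measure)) \<le>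
    ennreal ((1 + f_ratio \<alpha> (length js) CARD('l)) * (\<Sum>c\<in>UNIV. (norm (orth_resid v js (a c)))\<^sup>2))"
proof -
  \<comment> \<open>Multiplied by the real dimension, the assumption \<open>dims\<close> becomes the
    condition for finite inverse moments of the heights.\<close>
  have "real DIM('a) * (real \<alpha> + 1) = 2" using \<alpha> by simp
  moreover have "real DIM('a) * (real \<alpha> + 1) < real DIM('a) * (real CARD('l) - real (length js) + 1)"
    using dims by (intro mult_strict_left_mono) auto
  ultimately have d: "2 < real DIM('a) * (real CARD('l) - real (length js) + 1)" by simp
  have "(\<integral>\<^sup>+G. ennreal (\<Sum>c\<in>UNIV. (norm (oblique_resid G v js (a c)))\<^sup>2) \<partial>(gauss :: ('a^'n^'l) measure)) =
      (\<integral>\<^sup>+G. (\<Sum>c\<in>UNIV. ennreal ((norm (oblique_resid G v js (a c)))\<^sup>2)) \<partial>(gauss :: ('a^'n^'l) measure))"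
    by simp
  also have "\<dots> = (\<Sum>c\<in>UNIV. \<integral>\<^sup>+G. ennreal ((norm (oblique_resid G v js (a c)))\<^sup>2) \<partial>(gauss :: ('a^'n^'l) measure))"
    by (rule nn_integral_sum) simp
  also have "\<dots> \<le> (\<Sum>c\<in>UNIV. ennreal ((1 + f_ratio \<alpha> (length js) CARD('l)) * (norm (orth_resid v js (a c)))\<^sup>2))"
    using nn_integral_oblique_resid[OF on d] by (intro sum_mono) (simp add: f_ratio_def \<alpha>)
  also have "\<dots> = ennreal ((1 + f_ratio \<alpha> (length js) CARD('l)) * (\<Sum>c\<in>UNIV. (norm (orth_resid v js (a c)))\<^sup>2))"
    using f_ratio_nonneg[OF dims] by (simp add: sum_distrib_left)
  finally show ?thesis .
qed

text \<open>The bound is proved against each competitor \<open>B\<close> separately; the infimum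
  over \<open>B\<close> is taken last.\<close>

lemma nn_integral_range_error:
  fixes A :: "'a::hermitian_field^'n^'n" and q :: "'a^'k::{finite,linorder}^'n \<Rightarrow> 'a^'k::{finite,linorder}^'n"
  assumes \<alpha>: "real \<alpha> = 2 / real DIM('a) - 1"
    and A: "ctrans A = A" and q: "qr_rule q" and ks: "set ks = UNIV" "distinct ks"
    and \<rho>: "\<rho> + \<alpha> < CARD('k)"
  shows "(\<integral>\<^sup>+\<Omega>. ennreal (\<Sum>c\<in>UNIV. (norm (orth_resid (\<lambda>k. column k (q (A ** \<Omega>))) ks (column c A)))\<^sup>2) \<partial>gauss) \<le>
    ennreal ((1 + f_ratio \<alpha> \<rho> CARD('k)) * tail_energy_sq (\<rho> + 1) A)"
    (is "?I \<le> _")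
proof -
  let ?c = "1 + f_ratio \<alpha> \<rho> CARD('k)"
  have c: "0 < ?c" using f_ratio_nonneg[OF \<rho>] by simp
  have bound: "?I \<le> ennreal (?c * (norm (A - B))\<^sup>2)" if B: "rank B < \<rho> + 1" for B
  proof -
    obtain vs where on: "orthonormal (\<lambda>x. x) vs" and len: "length vs \<le> rank B"
      and tail: "(\<Sum>c\<in>UNIV. (norm (orth_resid (\<lambda>x. x) vs (column c A)))\<^sup>2) \<le> (norm (A - B))\<^sup>2"
      using sum_norm_orth_resid_le_tail[OF A, of B] by blast
    have len': "length vs \<le> \<rho>" using len B by simp
    have dims: "length vs + \<alpha> < CARD('k)" using len' \<rho> by simp
    let ?F = "\<lambda>G :: 'a^'n^'k::{finite,linorder}. ennreal (\<Sum>c\<in>UNIV. (norm (oblique_resid G (\<lambda>x. x) vs (column c A)))\<^sup>2)"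
    interpret coisometry "ctrans :: 'a^'n^'k::{finite,linorder} \<Rightarrow> 'a^'k::{finite,linorder}^'n" ctrans by (rule coisometry_ctrans)
    \<comment> \<open>Best approximation is compared pointwise with the oblique one built from
      \<open>vs\<close>.\<close>
    have "?I \<le> (\<integral>\<^sup>+\<Omega>. ?F (ctrans \<Omega>) \<partial>gauss)"
    proof (intro nn_integral_mono ennreal_leI)
      fix \<Omega> :: "'a^'k::{finite,linorder}^'n"
      obtain R where "A ** \<Omega> = q (A ** \<Omega>) ** R" "ctrans (q (A ** \<Omega>)) ** q (A ** \<Omega>) = mat 1"
        using q unfolding qr_rule_def by blast
      then show "(\<Sum>c\<in>UNIV. (norm (orth_resid (\<lambda>k. column k (q (A ** \<Omega>))) ks (column c A)))\<^sup>2) \<le>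
          (\<Sum>c\<in>UNIV. (norm (oblique_resid (ctrans \<Omega>) (\<lambda>x. x) vs (column c A)))\<^sup>2)"
        using A ks by (intro norm_orth_resid_range_le)
    qed
    also have "\<dots> = (\<integral>\<^sup>+G. ?F G \<partial>gauss)" by (rule nn_integral_adjoint) measurable
    also have "\<dots> \<le> ennreal ((1 + f_ratio \<alpha> (length vs) CARD('k)) *
        (\<Sum>c\<in>UNIV. (norm (orth_resid (\<lambda>x. x) vs (column c A)))\<^sup>2))"
      by (rule nn_integral_oblique_resid_sum[OF \<alpha> on dims])
    \<comment> \<open>The list \<open>vs\<close> may be shorter than \<open>\<rho>\<close>, so
      monotonicity of \<open>f_ratio\<close> is used.\<close>
    also have "\<dots> \<le> ennreal (?c * (norm (A - B))\<^sup>2)"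
      using f_ratio_mono[OF len' \<rho>] f_ratio_nonneg[OF dims] tail
      by (intro ennreal_leI mult_mono) (auto intro: sum_nonneg)
    finally show ?thesis .
  qed
  have rank_0: "rank (0 :: 'a^'n^'n) < \<rho> + 1"
  proof -
    have "rows (0 :: 'a^'n^'n) \<subseteq> vec.span {}" by (auto simp: rows_def row_def vec_eq_iff)
    then have "vec.dim (rows (0 :: 'a^'n^'n)) \<le> card ({} :: ('a^'n) set)"
      by (rule vec.dim_le_card) simp
    then show ?thesis unfolding row_rank_def_gen card.empty by linarith
  qed
  \<comment> \<open>The competitor 0 makes the integral finite, so the infimum can be handled in the
    reals after division by \<open>?c\<close>.\<close>
  from bound[OF rank_0] have "?I < \<infinity>" by (auto simp: less_top[symmetric] top_unique)
  then obtain x where x: "0 \<le> x" "?I = ennreal x" by (cases ?I) auto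
  have "x / ?c \<le> tail_energy_sq (\<rho> + 1) A"
    unfolding tail_energy_sq_def
  proof (rule cINF_greatest)
    show "{B :: 'a^'n^'n. rank B < \<rho> + 1} \<noteq> {}" using rank_0 by blast
  next
    fix B :: "'a^'n^'n" assume "B \<in> {B. rank B < \<rho> + 1}"
    then have "ennreal x \<le> ennreal (?c * (norm (A - B))\<^sup>2)" using bound x by simp
    then have "x \<le> ?c * (norm (A - B))\<^sup>2" using c by (subst (asm) ennreal_le_iff) auto
    then show "x / ?c \<le> (norm (A - B))\<^sup>2" using c by (simp add: field_simps)
  qed
  then show ?thesis using c x by (simp add: field_simps ennreal_leI)
qed

section \<open>Combining the bounds for the random sketch\<close>

lemma borel_measurable_column [measurable (raw)]:
  fixes f :: "'w \<Rightarrow> 'a::euclidean_space^'n^'m"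
  assumes [measurable]: "f \<in> borel_measurable M"
  shows "(\<lambda>x. column k (f x)) \<in> borel_measurable M"
  unfolding column_def by measurable

lemma borel_measurable_matrix_mult [measurable (raw)]:
  fixes f :: "'w \<Rightarrow> 'a::hermitian_field^'n^'m" and g :: "'w \<Rightarrow> 'a^'k^'n"
  assumes [measurable]: "f \<in> borel_measurable M" "g \<in> borel_measurable M"
  shows "(\<lambda>x. f x ** g x) \<in> borel_measurable M"
  unfolding matrix_matrix_mult_def by measurable

lemma nn_integral_error_A_hat_sym:
  fixes A :: "'a::hermitian_field^'n^'n" and \<Omega> :: "'w \<Rightarrow> 'a^'k::{finite,linorder}^'n"
    and \<Psi> :: "'w \<Rightarrow> 'a^'n^'l"
  assumes M: "prob_space M" and \<alpha>: "real \<alpha> = 2 / real DIM('a) - 1"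
    and dims: "CARD('k) + \<alpha> < CARD('l)" and A: "ctrans A = A"
    and \<Omega>: "distr M borel \<Omega> = gauss" and \<Psi>: "distr M borel \<Psi> = gauss"
    and indep: "indep_rv M \<Omega> \<Psi>" and q: "qr_rule q"
  shows "(\<integral>\<^sup>+\<omega>. ennreal ((norm (A - A_hat_sym q A (\<Omega> \<omega>) (\<Psi> \<omega>)))\<^sup>2) \<partial>M) \<le> sym_error_bound \<alpha> CARD('k) CARD('l) A"
proof -
  obtain ks :: "'k list" where ks: "set ks = UNIV" "distinct ks"
    using finite_distinct_list[of "UNIV :: 'k set"] by auto
  have length_ks: "length ks = CARD('k)" using distinct_card[OF ks(2)] ks(1) by simp
  define v where "v = (\<lambda>\<Omega> k. column k (q (A ** \<Omega>)))"
  have [measurable]: "q \<in> borel_measurable borel" using q by (simp add: qr_rule_def)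
  have [measurable]: "(\<lambda>x. v (f x) k) \<in> borel_measurable N" if [measurable]: "f \<in> borel_measurable N" for f k and N :: "'x measure"
    unfolding v_def by measurable
  have on: "orthonormal (v \<Omega>) ks" for \<Omega>
    using q ks unfolding v_def qr_rule_def by (intro orthonormal_columns) auto
  have [measurable]: "\<Omega> \<in> borel_measurable M" "\<Psi> \<in> borel_measurable M"
    using indep by (auto simp: indep_rv_def)
  have joint: "distr M borel (\<lambda>\<omega>. (\<Omega> \<omega>, \<Psi> \<omega>)) = gauss"
    using M indep \<Omega> \<Psi> by (rule distr_indep_gauss)
  have meas [measurable]: "(\<lambda>\<omega>. (\<Omega> \<omega>, \<Psi> \<omega>)) \<in> borel_measurable M" by measurable
  let ?F = "\<lambda>p :: ('a^'k::{finite,linorder}^'n) \<times> ('a^'n^'l). ennreal (\<Sum>c\<in>UNIV. (norm (oblique_resid (snd p) (v (fst p)) ks (column c A)))\<^sup>2)"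
  have F: "?F \<in> borel_measurable borel" unfolding borel_prod[symmetric] by measurable
  have d: "2 < real DIM('a) * (real CARD('l) - real (length ks) + 1)"
  proof -
    have "real DIM('a) * (real \<alpha> + 1) = 2" using \<alpha> by simp
    moreover have "real DIM('a) * (real \<alpha> + 1) < real DIM('a) * (real CARD('l) - real (length ks) + 1)"
      using dims by (intro mult_strict_left_mono) (auto simp: length_ks)
    ultimately show ?thesis by simp
  qed
  \<comment> \<open>For each fixed \<open>\<Omega>\<close> the columns of \<open>Q\<close> are fixed
    and orthonormal, so the almost sure statement is about \<open>\<Psi>\<close> alone.\<close>
  have "AE p in (gauss :: ('a^'k::{finite,linorder}^'n) measure) \<Otimes>\<^sub>M (gauss :: ('a^'n^'l) measure).
      \<forall>i\<in>set ks. height (snd p) (v (fst p)) ks i \<noteq> 0"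
  proof (rule gauss_pair.AE_pair_measure)
    show "{p \<in> space ((gauss :: ('a^'k::{finite,linorder}^'n) measure) \<Otimes>\<^sub>M (gauss :: ('a^'n^'l) measure)).
        \<forall>i\<in>set ks. height (snd p) (v (fst p)) ks i \<noteq> 0} \<in> sets (gauss \<Otimes>\<^sub>M gauss)"
      by measurable
    show "AE \<Omega> in gauss. AE \<Psi> in (gauss :: ('a^'n^'l) measure).
        \<forall>i\<in>set ks. height (snd (\<Omega>, \<Psi>)) (v (fst (\<Omega>, \<Psi>))) ks i \<noteq> 0"
      using AE_height_nonzero[OF on d] by simp
  qed
  then have AE: "AE \<omega> in M. \<forall>i\<in>set ks. height (\<Psi> \<omega>) (v (\<Omega> \<omega>)) ks i \<noteq> 0"
    unfolding gauss_pair_measure joint[symmetric] by (drule_tac AE_distrD[OF meas]) simp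
  \<comment> \<open>The error is dominated by \<open>?F\<close>, whose measurability is explicit;
    the law of the pair can then be substituted.\<close>
  have "(\<integral>\<^sup>+\<omega>. ennreal ((norm (A - A_hat_sym q A (\<Omega> \<omega>) (\<Psi> \<omega>)))\<^sup>2) \<partial>M) \<le> (\<integral>\<^sup>+\<omega>. ?F (\<Omega> \<omega>, \<Psi> \<omega>) \<partial>M)"
  proof (rule nn_integral_mono_AE)
    show "AE \<omega> in M. ennreal ((norm (A - A_hat_sym q A (\<Omega> \<omega>) (\<Psi> \<omega>)))\<^sup>2) \<le> ?F (\<Omega> \<omega>, \<Psi> \<omega>)"
      using AE
    proof eventually_elim
      case (elim \<omega>)
      have "(norm (A - A_hat_sym q A (\<Omega> \<omega>) (\<Psi> \<omega>)))\<^sup>2 \<le> (norm (A - A_hat q A (\<Omega> \<omega>) (\<Psi> \<omega>)))\<^sup>2"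
        by (intro power_mono norm_error_A_hat_sym_le A) simp
      also have "\<dots> = (\<Sum>c\<in>UNIV. (norm (oblique_resid (\<Psi> \<omega>) (v (\<Omega> \<omega>)) ks (column c A)))\<^sup>2)"
        using column_error_A_hat[where q = q and A = A and \<Omega> = "\<Omega> \<omega>" and \<Psi> = "\<Psi> \<omega>", OF elim[unfolded v_def] ks]
        by (simp only: norm_square_columns v_def)
      finally show ?case by (simp only: fst_conv snd_conv ennreal_leI)
    qed
  qed
  also have "\<dots> = (\<integral>\<^sup>+p. ?F p \<partial>gauss)"
    using F by (subst joint[symmetric], subst nn_integral_distr) simp_all
  also have "\<dots> = (\<integral>\<^sup>+\<Omega>. \<integral>\<^sup>+\<Psi>. ?F (\<Omega>, \<Psi>) \<partial>gauss \<partial>gauss)"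
    by (rule nn_integral_gauss_pair[OF F])
  \<comment> \<open>The integral over \<open>\<Psi>\<close> gives the first factor of the bound; the
    orthogonal residual left over depends on \<open>\<Omega>\<close> only.\<close>
  also have "\<dots> \<le> (\<integral>\<^sup>+\<Omega>. ennreal (1 + f_ratio \<alpha> CARD('k) CARD('l)) *
      ennreal (\<Sum>c\<in>UNIV. (norm (orth_resid (v \<Omega>) ks (column c A)))\<^sup>2) \<partial>gauss)"
  proof (rule nn_integral_mono)
    fix \<Omega> :: "'a^'k::{finite,linorder}^'n"
    show "(\<integral>\<^sup>+\<Psi>. ?F (\<Omega>, \<Psi>) \<partial>gauss) \<le> ennreal (1 + f_ratio \<alpha> CARD('k) CARD('l)) *
        ennreal (\<Sum>c\<in>UNIV. (norm (orth_resid (v \<Omega>) ks (column c A)))\<^sup>2)"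
      using nn_integral_oblique_resid_sum[OF \<alpha> on[of \<Omega>], where 'l = 'l and a = "\<lambda>c. column c A"] dims
      by (simp add: length_ks ennreal_mult'' sum_nonneg)
  qed
  also have "\<dots> = ennreal (1 + f_ratio \<alpha> CARD('k) CARD('l)) *
      (\<integral>\<^sup>+\<Omega>. ennreal (\<Sum>c\<in>UNIV. (norm (orth_resid (v \<Omega>) ks (column c A)))\<^sup>2) \<partial>gauss)"
    by (rule nn_integral_cmult) measurable
  \<comment> \<open>The range error is bounded for every admissible \<open>\<rho>\<close>, hence by
    the infimum; an empty index set gives the top element.\<close>
  also have "\<dots> \<le> sym_error_bound \<alpha> CARD('k) CARD('l) A"
    unfolding sym_error_bound_def v_def using \<alpha> A q ks
    by (intro mult_left_mono INF_greatest nn_integral_range_error) auto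
  finally show ?thesis .
qed

text \<open>Both fields are instances of one bound: \<open>2 / DIM('a) - 1\<close> is 1 for the
  reals and 0 for the complex numbers.\<close>

theorem corollary5p3:
  fixes M :: "'w measure"
  assumes "prob_space M"
    and "CARD('l::finite) \<le> CARD('n::finite)"
  shows
    "(\<forall>(A :: real^'n^'n) (\<Omega> :: 'w \<Rightarrow> real^'k::{finite,linorder}^'n) (\<Psi> :: 'w \<Rightarrow> real^'n^'l) q.
        CARD('k) + 1 < CARD('l) \<longrightarrow> ctrans A = A \<longrightarrow>
        real_std_normal M \<Omega> \<longrightarrow> real_std_normal M \<Psi> \<longrightarrow> indep_rv M \<Omega> \<Psi> \<longrightarrow> qr_rule q \<longrightarrow>
        (\<forall>\<omega>\<in>space M. ctrans (A_hat_sym q A (\<Omega> \<omega>) (\<Psi> \<omega>)) = A_hat_sym q A (\<Omega> \<omega>) (\<Psi> \<omega>) \<and>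
           rank (A_hat_sym q A (\<Omega> \<omega>) (\<Psi> \<omega>)) \<le> 2 * CARD('k)) \<and>
        (\<integral>\<^sup>+ \<omega>. ennreal ((norm (A - A_hat_sym q A (\<Omega> \<omega>) (\<Psi> \<omega>)))\<^sup>2) \<partial>M)
          \<le> sym_error_bound 1 CARD('k) CARD('l) A) \<and>
     (\<forall>(A :: complex^'n^'n) (\<Omega> :: 'w \<Rightarrow> complex^'k::{finite,linorder}^'n) (\<Psi> :: 'w \<Rightarrow> complex^'n^'l) q.
        CARD('k) < CARD('l) \<longrightarrow> ctrans A = A \<longrightarrow>
        complex_std_normal M \<Omega> \<longrightarrow> complex_std_normal M \<Psi> \<longrightarrow> indep_rv M \<Omega> \<Psi> \<longrightarrow> qr_rule q \<longrightarrow>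
        (\<forall>\<omega>\<in>space M. ctrans (A_hat_sym q A (\<Omega> \<omega>) (\<Psi> \<omega>)) = A_hat_sym q A (\<Omega> \<omega>) (\<Psi> \<omega>) \<and>
           rank (A_hat_sym q A (\<Omega> \<omega>) (\<Psi> \<omega>)) \<le> 2 * CARD('k)) \<and>
        (\<integral>\<^sup>+ \<omega>. ennreal ((norm (A - A_hat_sym q A (\<Omega> \<omega>) (\<Psi> \<omega>)))\<^sup>2) \<partial>M)
          \<le> sym_error_bound 0 CARD('k) CARD('l) A)"
proof (intro conjI allI impI ballI)
  fix A :: "real^'n^'n" and \<Omega> :: "'w \<Rightarrow> real^'k::{finite,linorder}^'n" and \<Psi> :: "'w \<Rightarrow> real^'n^'l"
    and q :: "real^'k::{finite,linorder}^'n \<Rightarrow> real^'k::{finite,linorder}^'n"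
  assume "CARD('k) + 1 < CARD('l)" "ctrans A = A" "real_std_normal M \<Omega>" "real_std_normal M \<Psi>"
    "indep_rv M \<Omega> \<Psi>" "qr_rule q"
  then show "(\<integral>\<^sup>+ \<omega>. ennreal ((norm (A - A_hat_sym q A (\<Omega> \<omega>) (\<Psi> \<omega>)))\<^sup>2) \<partial>M)
      \<le> sym_error_bound 1 CARD('k) CARD('l) A"
    using assms(1) by (intro nn_integral_error_A_hat_sym distr_real_std_normal) auto
next
  fix A :: "complex^'n^'n" and \<Omega> :: "'w \<Rightarrow> complex^'k::{finite,linorder}^'n" and \<Psi> :: "'w \<Rightarrow> complex^'n^'l"
    and q :: "complex^'k::{finite,linorder}^'n \<Rightarrow> complex^'k::{finite,linorder}^'n"
  assume "CARD('k) < CARD('l)" "ctrans A = A" "complex_std_normal M \<Omega>" "complex_std_normal M \<Psi>"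
    "indep_rv M \<Omega> \<Psi>" "qr_rule q"
  then show "(\<integral>\<^sup>+ \<omega>. ennreal ((norm (A - A_hat_sym q A (\<Omega> \<omega>) (\<Psi> \<omega>)))\<^sup>2) \<partial>M)
      \<le> sym_error_bound 0 CARD('k) CARD('l) A"
    using assms(1) by (intro nn_integral_error_A_hat_sym distr_complex_std_normal) auto
qed (rule ctrans_A_hat_sym rank_A_hat_sym)+

end
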